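(* Let $n\ge 1$ and let $L_1$ and $L_2$ be virtual string link diagrams on $n$ strands. Then the following are equivalent: (1) $L_1$ is cobordant to $L_2$; (2) $L_1$ is unwelded equivalent to $L_2$; (3) the pairwise virtual linking numbers of the components of $L_1$ equal those of $L_2$, i.e. for all ordered pairs $(i,j)$ with $1\le i\ne j\le n$, $\operatorname{lk}((L_1)_{(i)},(L_1)_{(j)})=\operatorname{lk}((L_2)_{(i)},(L_2)_{(j)})$.
   Context: Diagrams. A Gauss diagram consists of a skeleton (a finite disjoint union of oriented intervals and oriented circles) together with finitely many signed arrows (signs $\pm1$) whose endpoints (tail and head) are distinct points in the interior of the skeleton, considered up to orientation-preserving homeomorphism of the skeleton fixing the labels of the intervals. A virtual string link diagram on $n$ strands is (equivalently to a planar diagram with classical and virtual crossings) a Gauss diagram whose skeleton is $n$ oriented intervals labelled $1,\dots,n$ and no circles; $L_{(i)}$ is the $i$-th strand. An arrow represents a classical crossing, pointing from the overcrossing strand to the undercrossing strand; its sign is the writhe $\operatorname{w}(c)$. Virtual crossings are not recorded. Two arrow endpoints are adjacent if they bound an arc of the skeleton with no other arrow endpoint in its interior. Reidemeister moves on Gauss diagrams. RM1: add or delete an arrow (any sign and direction) whose two endpoints are adjacent. RM2: add or delete two arrows of opposite signs whose tails are adjacent and whose heads are adjacent (in either relative order), the arcs between the tails and between the heads being disjoint. RM3: suppose there are three disjoint arcs $t,m,b$ of the skeleton and arrows $x:t\to m$, $y:t\to b$, $z:m\to b$, with no other endpoints on these arcs, and suppose there are $\delta,\varepsilon_t,\varepsilon_m,\varepsilon_b\in\{\pm1\}$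 such that the signs of $x,y,z$ are $\delta\varepsilon_t\varepsilon_m$, $\delta\varepsilon_t\varepsilon_b$, $\delta\varepsilon_m\varepsilon_b$, and such that $x$ precedes $y$ on $t$ iff $\varepsilon_t=1$, $x$ precedes $z$ on $m$ iff $\varepsilon_m=1$, $y$ precedes $z$ on $b$ iff $\varepsilon_b=1$; then the order of the two endpoints is exchanged simultaneously on each of the three arcs. Forbidden moves. $f1$ exchanges two adjacent arrow tails; $f2$ exchanges two adjacent arrow heads (arbitrary signs). Two virtual string link diagrams are unwelded equivalent if they are related by a finite sequence of Reidemeister moves and moves $f1$, $f2$. Cobordism. A cobordism between two virtual string link diagrams on $n$ strands is a finite sequence of Reidemeister moves, births (adding a circle to the skeleton carrying no arrow endpoints), deaths (deleting a circle carrying no arrow endpoints), and oriented saddle moves (choose two points of the skeleton that are not arrow endpoints, cut there and reconnect in the other orientation-respecting way), starting at one diagram and ending at the other, such that the abstract surface described by the sequence (skeleton $\times$ interval, with disks attached for births and deaths and a band for each saddle) has precisely $n$ connected components, i.e. each connected component contains exactly one strand of each end diagram. There is no restriction on genus. Two diagrams are cobordant if there is a cobordism between them. Linking numbers. For distinct components, $\operatorname{lk}(L_{(i)},L_{(j)})=\sum_{c:L_{(i)}\to L_{(j)}}\operatorname{w}(c)$, the sum of the signs of the arrows with tail on $L_{(i)}$ and head on $L_{(j)}$. *)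

theory Defs
  imports Main
begin

section \<open>Gauss diagrams\<close>

datatype 'a endpoint = Tail (arrow_of: 'a) | Head (arrow_of: 'a)

datatype component = Strand nat | Circle nat

text \<open>
  The intervals of the skeleton are \<open>Strand 1, \<dots>, Strand n\<close>, and its circles are \<open>Circle k\<close>
  for \<open>k\<close> in a finite set of names. A diagram stores, for each component, the word of arrow
  endpoints met along its orientation; the word of a circle is read from an arbitrary base point,
  so it matters only up to rotation. Names of arrows and circles, the words of absent components
  and the writhes of absent arrows carry no information: all of this is factored out by
  \<open>isotopy\<close> below. Within a cobordism, where a saddle may reconnect two intervals, an interval
  is labelled by its initial point.
\<close>

record gauss_diagram =
  strands :: nat
  circs :: "nat set"
  word :: "component \<Rightarrow> nat endpoint list"
  writhe :: "nat \<Rightarrow> int"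

definition components :: "gauss_diagram \<Rightarrow> component set" where
  "components D = Strand ` {1..strands D} \<union> Circle ` circs D"

definition endpoints :: "gauss_diagram \<Rightarrow> nat endpoint set" where
  "endpoints D = (\<Union>c\<in>components D. set (word D c))"

definition arrows :: "gauss_diagram \<Rightarrow> nat set" where
  "arrows D = arrow_of ` endpoints D"

definition wf_gauss :: "gauss_diagram \<Rightarrow> bool" where
  "wf_gauss D \<longleftrightarrow>
     finite (circs D) \<and>
     (\<forall>c\<in>components D. distinct (word D c)) \<and>
     (\<forall>c\<in>components D. \<forall>c'\<in>components D.
        c \<noteq> c' \<longrightarrow> set (word D c) \<inter> set (word D c') = {}) \<and>
     (\<forall>a\<in>arrows D. Tail a \<in> endpoints D \<and> Head a \<in> endpoints D \<and> writhe D a \<in> {1, -1})"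

definition virtual_string_link :: "nat \<Rightarrow> gauss_diagram \<Rightarrow> bool" where
  "virtual_string_link n D \<longleftrightarrow> wf_gauss D \<and> strands D = n \<and> circs D = {}"

text \<open>\<open>lk D i j\<close> is the linking number of the \<open>i\<close>-th strand over the \<open>j\<close>-th.\<close>

definition lk :: "gauss_diagram \<Rightarrow> nat \<Rightarrow> nat \<Rightarrow> int" where
  "lk D i j =
     (\<Sum>a\<in>{a. Tail a \<in> set (word D (Strand i)) \<and> Head a \<in> set (word D (Strand j))}. writhe D a)"

text \<open>
  Orientation-preserving homeomorphism of skeletons respecting the arrows and fixing the labels of
  the intervals, with \<open>\<pi>\<close> its effect on circles and \<open>f\<close> its effect on arrows.
\<close>

definition isotopy :: "(nat \<Rightarrow> nat) \<Rightarrow> gauss_diagram \<Rightarrow> gauss_diagram \<Rightarrow> bool" where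
  "isotopy \<pi> D E \<longleftrightarrow>
     strands E = strands D \<and> bij_betw \<pi> (circs D) (circs E) \<and>
     (\<exists>f. inj_on f (arrows D) \<and>
        (\<forall>a\<in>arrows D. writhe E (f a) = writhe D a) \<and>
        (\<forall>i\<in>{1..strands D}. word E (Strand i) = map (map_endpoint f) (word D (Strand i))) \<and>
        (\<forall>k\<in>circs D. \<exists>r.
           word E (Circle (\<pi> k)) = rotate r (map (map_endpoint f) (word D (Circle k)))))"


section \<open>Reidemeister and forbidden moves\<close>

text \<open>
  \<open>consec D p q\<close>: some arc of the skeleton runs, along the orientation, from \<open>p\<close> to \<open>q\<close> with no
  other endpoint on it. Two such arcs with four distinct ends are automatically disjoint, so the
  disjointness of arcs in the moves below needs no separate condition.
\<close>

definition consec :: "gauss_diagram \<Rightarrow> nat endpoint \<Rightarrow> nat endpoint \<Rightarrow> bool" where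
  "consec D p q \<longleftrightarrow>
     (\<exists>c\<in>components D. \<exists>u v. word D c = u @ p # q # v) \<or>
     (\<exists>k\<in>circs D. \<exists>u. word D (Circle k) = q # u @ [p])"

definition adjacent :: "gauss_diagram \<Rightarrow> nat endpoint \<Rightarrow> nat endpoint \<Rightarrow> bool" where
  "adjacent D p q \<longleftrightarrow> consec D p q \<or> consec D q p"

definition delete_arrows :: "nat set \<Rightarrow> gauss_diagram \<Rightarrow> gauss_diagram" where
  "delete_arrows A D = D\<lparr>word := \<lambda>c. filter (\<lambda>p. arrow_of p \<notin> A) (word D c)\<rparr>"

definition exchange :: "nat endpoint \<Rightarrow> nat endpoint \<Rightarrow> gauss_diagram \<Rightarrow> gauss_diagram" where
  "exchange p q D = D\<lparr>word := \<lambda>c. map (id(p := q, q := p)) (word D c)\<rparr>"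

definition rm1_delete :: "gauss_diagram \<Rightarrow> gauss_diagram \<Rightarrow> bool" where
  "rm1_delete D E \<longleftrightarrow> (\<exists>a. adjacent D (Tail a) (Head a) \<and> E = delete_arrows {a} D)"

definition rm2_delete :: "gauss_diagram \<Rightarrow> gauss_diagram \<Rightarrow> bool" where
  "rm2_delete D E \<longleftrightarrow>
     (\<exists>a b. a \<noteq> b \<and> writhe D a = - writhe D b \<and>
        adjacent D (Tail a) (Tail b) \<and> adjacent D (Head a) (Head b) \<and>
        E = delete_arrows {a, b} D)"

definition consec_sgn :: "gauss_diagram \<Rightarrow> int \<Rightarrow> nat endpoint \<Rightarrow> nat endpoint \<Rightarrow> bool" where
  "consec_sgn D \<epsilon> p q \<longleftrightarrow> (if \<epsilon> = 1 then consec D p q else consec D q p)"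

definition rm3 :: "gauss_diagram \<Rightarrow> gauss_diagram \<Rightarrow> bool" where
  "rm3 D E \<longleftrightarrow>
     (\<exists>x y z \<delta> \<epsilon>t \<epsilon>m \<epsilon>b. distinct [x, y, z] \<and>
        \<delta> \<in> {1, -1} \<and> \<epsilon>t \<in> {1, -1} \<and> \<epsilon>m \<in> {1, -1} \<and> \<epsilon>b \<in> {1, -1} \<and>
        writhe D x = \<delta> * \<epsilon>t * \<epsilon>m \<and> writhe D y = \<delta> * \<epsilon>t * \<epsilon>b \<and> writhe D z = \<delta> * \<epsilon>m * \<epsilon>b \<and>
        consec_sgn D \<epsilon>t (Tail x) (Tail y) \<and>
        consec_sgn D \<epsilon>m (Head x) (Tail z) \<and>
        consec_sgn D \<epsilon>b (Head y) (Head z) \<and>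
        E = exchange (Tail x) (Tail y)
              (exchange (Head x) (Tail z) (exchange (Head y) (Head z) D)))"

definition reidemeister :: "gauss_diagram \<Rightarrow> gauss_diagram \<Rightarrow> bool" where
  "reidemeister D E \<longleftrightarrow>
     rm1_delete D E \<or> rm1_delete E D \<or> rm2_delete D E \<or> rm2_delete E D \<or> rm3 D E"

definition forbidden1 :: "gauss_diagram \<Rightarrow> gauss_diagram \<Rightarrow> bool" where
  "forbidden1 D E \<longleftrightarrow>
     (\<exists>a b. adjacent D (Tail a) (Tail b) \<and> E = exchange (Tail a) (Tail b) D)"

definition forbidden2 :: "gauss_diagram \<Rightarrow> gauss_diagram \<Rightarrow> bool" where
  "forbidden2 D E \<longleftrightarrow>
     (\<exists>a b. adjacent D (Head a) (Head b) \<and> E = exchange (Head a) (Head b) D)"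

definition unwelded_step :: "gauss_diagram \<Rightarrow> gauss_diagram \<Rightarrow> bool" where
  "unwelded_step D E \<longleftrightarrow> wf_gauss D \<and> wf_gauss E \<and>
     ((\<exists>\<pi>. isotopy \<pi> D E) \<or> reidemeister D E \<or> forbidden1 D E \<or> forbidden2 D E)"

definition unwelded_equivalent :: "gauss_diagram \<Rightarrow> gauss_diagram \<Rightarrow> bool" where
  "unwelded_equivalent = unwelded_step\<^sup>*\<^sup>*"


section \<open>Cobordism\<close>

text \<open>
  The saddle moves. Cutting one component at two of its points splits off a circle. The reverse
  reconnects a circle with another component. Cutting two different intervals interchanges their
  final parts. In \<open>saddle_split c k D E\<close> the word of a circle \<open>c\<close> is cut, cyclically, into the two
  arcs \<open>w @ u\<close> and \<open>v\<close>, the former then being read from the old base point.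
\<close>

definition saddle_split :: "component \<Rightarrow> nat \<Rightarrow> gauss_diagram \<Rightarrow> gauss_diagram \<Rightarrow> bool" where
  "saddle_split c k D E \<longleftrightarrow> c \<in> components D \<and> k \<notin> circs D \<and>
     (\<exists>u v w. word D c = u @ v @ w \<and>
        E = D\<lparr>circs := insert k (circs D), word := (word D)(c := u @ w, Circle k := v)\<rparr>)"

definition saddle_strands :: "nat \<Rightarrow> nat \<Rightarrow> gauss_diagram \<Rightarrow> gauss_diagram \<Rightarrow> bool" where
  "saddle_strands i j D E \<longleftrightarrow> i \<in> {1..strands D} \<and> j \<in> {1..strands D} \<and> i \<noteq> j \<and>
     (\<exists>u v u' v'. word D (Strand i) = u @ v \<and> word D (Strand j) = u' @ v' \<and>
        E = D\<lparr>word := (word D)(Strand i := u @ v', Strand j := u' @ v)\<rparr>)"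

text \<open>
  \<open>cob_step D R E\<close>: one step from \<open>D\<close> to \<open>E\<close>, where \<open>(c, c') \<in> R\<close> iff the components \<open>c\<close> of \<open>D\<close>
  and \<open>c'\<close> of \<open>E\<close> bound the same connected piece of the slab of surface swept out by the step.
  The disk of a birth or death bounds a single circle at one level and so contributes no pair.
\<close>

inductive cob_step ::
    "gauss_diagram \<Rightarrow> (component \<times> component) set \<Rightarrow> gauss_diagram \<Rightarrow> bool" where
  cob_isotopy: "isotopy \<pi> D E \<Longrightarrow>
    cob_step D ({(Strand i, Strand i) | i. i \<in> {1..strands D}}
                \<union> {(Circle k, Circle (\<pi> k)) | k. k \<in> circs D}) E"
| cob_reidemeister: "reidemeister D E \<Longrightarrow> cob_step D (Id_on (components D)) E"
| cob_birth: "k \<notin> circs D \<Longrightarrow>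
    cob_step D (Id_on (components D))
      (D\<lparr>circs := insert k (circs D), word := (word D)(Circle k := [])\<rparr>)"
| cob_death: "k \<in> circs D \<Longrightarrow> word D (Circle k) = [] \<Longrightarrow>
    cob_step D (Id_on (components D - {Circle k})) (D\<lparr>circs := circs D - {k}\<rparr>)"
| cob_split: "saddle_split c k D E \<Longrightarrow>
    cob_step D (insert (c, Circle k) (Id_on (components D))) E"
| cob_merge: "saddle_split c k E D \<Longrightarrow>
    cob_step D (insert (Circle k, c) (Id_on (components E))) E"
| cob_strands: "saddle_strands i j D E \<Longrightarrow>
    cob_step D ({(Strand i, Strand j), (Strand j, Strand i)} \<union> Id_on (components D)) E"

definition movie ::
    "nat \<Rightarrow> (nat \<Rightarrow> gauss_diagram) \<Rightarrow> (nat \<Rightarrow> (component \<times> component) set) \<Rightarrow> bool" where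
  "movie m D R \<longleftrightarrow>
     (\<forall>t\<le>m. wf_gauss (D t)) \<and> (\<forall>t<m. cob_step (D t) (R t) (D (Suc t)))"

text \<open>
  Connected components of the surface described by a movie, each represented by the set of those
  skeleton components \<open>(t, c)\<close>, at the levels \<open>t = 0, \<dots>, m\<close>, which lie on it.
\<close>

definition levels :: "nat \<Rightarrow> (nat \<Rightarrow> gauss_diagram) \<Rightarrow> (nat \<times> component) set" where
  "levels m D = (SIGMA t:{0..m}. components (D t))"

definition joined ::
    "nat \<Rightarrow> (nat \<Rightarrow> (component \<times> component) set) \<Rightarrow> ((nat \<times> component) \<times> (nat \<times> component)) set"
  where "joined m R = {((t, c), (Suc t, c')) | t c c'. t < m \<and> (c, c') \<in> R t}"

definition surface_components ::
    "nat \<Rightarrow> (nat \<Rightarrow> gauss_diagram) \<Rightarrow> (nat \<Rightarrow> (component \<times> component) set)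
      \<Rightarrow> (nat \<times> component) set set" where
  "surface_components m D R = levels m D // (joined m R \<union> (joined m R)\<inverse>)\<^sup>*"

definition cobordant :: "nat \<Rightarrow> gauss_diagram \<Rightarrow> gauss_diagram \<Rightarrow> bool" where
  "cobordant n L L' \<longleftrightarrow>
     (\<exists>m D R. D 0 = L \<and> D m = L' \<and> movie m D R \<and>
        card (surface_components m D R) = n \<and>
        (\<forall>K\<in>surface_components m D R.
           (\<exists>!i. i \<in> {1..n} \<and> (0, Strand i) \<in> K) \<and>
           (\<exists>!i. i \<in> {1..n} \<and> (m, Strand i) \<in> K)))"

end

theory Submission
  imports Defs "HOL-Library.Multiset"
begin

text \<open>
  Linking numbers are invariant under cobordism because the components of the surface group the
  circles and strands of each intermediate diagram into \<open>n\<close> families, and the linking number of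
  two distinct families never changes.

  Conversely, both equivalence relations allow the exchange of any two adjacent arrow endpoints.
  For unwelded equivalence, a head and a tail are exchanged by an RM3 involving an auxiliary pair of
  cancelling arrows, which the forbidden moves then disentangle. For cobordism, a saddle splits off
  a circle containing just the two endpoints, which is rotated and merged back, creating genus one.
  Hence endpoints may be permuted arbitrarily along each strand. RM1 then removes all arrows
  from a strand to itself, and RM2 removes pairs of arrows of opposite signs between the same two
  strands. What remains is determined by the linking numbers.
\<close>

text \<open>Neither relation is translated into the other. Both lie between a small set of moves,
  \<open>link_step\<close>, and equality of linking numbers, so closing this gap once proves all
  implications.

  Invariance has to cope with the circles in the intermediate diagrams of a cobordism: no linking
  number of single components is preserved when circles split and merge. This forces linking numbers
  of labelled families, with labels constant on the pieces of surface. Only distinct families are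
  compared, since RM1 changes the linking of a family with itself.

  The construction has to produce a surface with exactly \<open>n\<close> components. Every circle
  is split off an existing component, so each part of the surface can be followed back to an initial
  strand; the genus created on the way is unrestricted. Gluing of cobordisms is avoided: a single
  movie is prolonged move by move, and its surface is examined only at the end.

  Diagrams are records with meaningless data on absent components and arrows. Results of moves
  therefore often agree only on the data that count, and an isotopy with identity maps bridges the
  difference.\<close>

section \<open>Well-formed diagrams, exchanges and deletions\<close>

lemma components_cong:
  "strands E = strands D \<Longrightarrow> circs E = circs D \<Longrightarrow> components E = components D"
  by (simp add: components_def)

lemma Strand_in_components [simp]: "Strand i \<in> components D \<longleftrightarrow> i \<in> {1..strands D}"
  by (auto simp: components_def)

lemma Circle_in_components [simp]: "Circle k \<in> components D \<longleftrightarrow> k \<in> circs D"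
  by (auto simp: components_def)

lemma finite_components: "wf_gauss D \<Longrightarrow> finite (components D)"
  by (simp add: components_def wf_gauss_def)

lemma finite_arrows: "wf_gauss D \<Longrightarrow> finite (arrows D)"
  by (simp add: arrows_def endpoints_def finite_components)

lemma in_arrows_iff:
  assumes "wf_gauss D"
  shows "a \<in> arrows D \<longleftrightarrow> Tail a \<in> endpoints D" "a \<in> arrows D \<longleftrightarrow> Head a \<in> endpoints D"
proof -
  have "Tail a \<in> endpoints D" "Head a \<in> endpoints D" if "a \<in> arrows D"
    using assms that unfolding wf_gauss_def by blast+
  moreover have "a \<in> arrows D" if "p \<in> endpoints D" "arrow_of p = a" for p
    using that by (auto simp: arrows_def)
  ultimately show "a \<in> arrows D \<longleftrightarrow> Tail a \<in> endpoints D"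
      "a \<in> arrows D \<longleftrightarrow> Head a \<in> endpoints D"
    by fastforce+
qed

lemma wf_gauss_distinct: "wf_gauss D \<Longrightarrow> c \<in> components D \<Longrightarrow> distinct (word D c)"
  by (simp add: wf_gauss_def)

lemma wf_gauss_unique_component:
  assumes "wf_gauss D" "c \<in> components D" "c' \<in> components D"
    and "p \<in> set (word D c)" "p \<in> set (word D c')"
  shows "c' = c"
  using assms unfolding wf_gauss_def by blast

lemma endpoints_cong:
  assumes "components E = components D"
    and "\<And>c. c \<in> components D \<Longrightarrow> set (word E c) = set (word D c)"
  shows "endpoints E = endpoints D"
  using assms by (simp add: endpoints_def)

lemma wf_gauss_cong:
  assumes "wf_gauss D" "strands E = strands D" "circs E = circs D"
    and "\<And>c. c \<in> components D \<Longrightarrow> distinct (word E c) \<and> set (word E c) = set (word D c)"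
    and "\<And>a. a \<in> arrows D \<Longrightarrow> writhe E a = writhe D a"
  shows "wf_gauss E"
proof -
  have comp: "components E = components D"
    using assms(2,3) by (rule components_cong)
  have "endpoints E = endpoints D"
    by (rule endpoints_cong[OF comp]) (simp add: assms(4))
  moreover have "finite (circs E)" using assms(1,3) by (simp add: wf_gauss_def)
  ultimately show ?thesis
    using assms(1,4,5) unfolding wf_gauss_def arrows_def comp by auto
qed

lemma exchange_simps [simp]:
  "strands (exchange p q D) = strands D" "circs (exchange p q D) = circs D"
  "writhe (exchange p q D) = writhe D" "components (exchange p q D) = components D"
  by (simp_all add: exchange_def components_def)

lemma word_exchange: "word (exchange p q D) c = map (id(p := q, q := p)) (word D c)"
  by (simp add: exchange_def)

lemma delete_arrows_simps [simp]:
  "strands (delete_arrows A D) = strands D" "circs (delete_arrows A D) = circs D"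
  "writhe (delete_arrows A D) = writhe D" "components (delete_arrows A D) = components D"
  "word (delete_arrows A D) c = filter (\<lambda>p. arrow_of p \<notin> A) (word D c)"
  by (simp_all add: delete_arrows_def components_def)

lemma endpoints_delete_arrows:
  "endpoints (delete_arrows A D) = {p \<in> endpoints D. arrow_of p \<notin> A}"
  by (auto simp: endpoints_def)

lemma arrows_delete_arrows: "arrows (delete_arrows A D) = arrows D - A"
  by (auto simp: arrows_def endpoints_delete_arrows)

lemma wf_delete_arrows:
  assumes "wf_gauss D"
  shows "wf_gauss (delete_arrows A D)"
  using assms unfolding wf_gauss_def arrows_delete_arrows endpoints_delete_arrows
  by simp blast

lemma inj_transposition: "inj (id(p := q, q := p))"
  by (auto simp: inj_def)

lemma image_transposition:
  "p \<in> S \<longleftrightarrow> q \<in> S \<Longrightarrow> id(p := q, q := p) ` S = S"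
  by (auto simp: image_iff)

text \<open>The coarse consequence of adjacency that suffices for an exchange to preserve
  well-formedness and linking numbers. Unlike adjacency, it is unaffected by exchanges of other
  endpoints within their components, so it passes through a chain of exchanges unchanged.\<close>

definition same_component :: "gauss_diagram \<Rightarrow> nat endpoint \<Rightarrow> nat endpoint \<Rightarrow> bool" where
  "same_component D p q \<longleftrightarrow> (\<exists>c\<in>components D. p \<in> set (word D c) \<and> q \<in> set (word D c))"

lemma consec_same_component: "consec D p q \<Longrightarrow> same_component D p q"
  unfolding consec_def same_component_def by (force simp: components_def)

lemma same_component_sym: "same_component D p q \<Longrightarrow> same_component D q p"
  by (auto simp: same_component_def)

lemma adjacent_same_component: "adjacent D p q \<Longrightarrow> same_component D p q"
  unfolding adjacent_def using consec_same_component same_component_sym by blast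

lemma consec_sgn_same_component: "consec_sgn D \<epsilon> p q \<Longrightarrow> same_component D p q"
  unfolding consec_sgn_def using consec_same_component same_component_sym by (metis (full_types))

lemma set_word_exchange:
  assumes "wf_gauss D" "same_component D p q" "c \<in> components D"
  shows "set (word (exchange p q D) c) = set (word D c)"
proof -
  have "p \<in> set (word D c) \<longleftrightarrow> q \<in> set (word D c)"
    using assms unfolding same_component_def by (metis wf_gauss_unique_component)
  then show ?thesis
    by (simp only: word_exchange set_map image_transposition)
qed

lemma wf_exchange:
  assumes "wf_gauss D" "same_component D p q"
  shows "wf_gauss (exchange p q D)"
proof (rule wf_gauss_cong[OF assms(1)])
  fix c assume c: "c \<in> components D"
  have "distinct (word (exchange p q D) c)"
    using wf_gauss_distinct[OF assms(1) c]
    unfolding word_exchange distinct_map by (metis inj_on_subset inj_transposition subset_UNIV)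
  then show "distinct (word (exchange p q D) c) \<and> set (word (exchange p q D) c) = set (word D c)"
    using set_word_exchange[OF assms c] by blast
qed simp_all

lemma same_component_exchange:
  assumes "wf_gauss D" "same_component D p q"
  shows "same_component (exchange p q D) x y \<longleftrightarrow> same_component D x y"
  by (simp add: same_component_def set_word_exchange[OF assms])

section \<open>Invariance of the linking numbers\<close>

definition ends :: "gauss_diagram \<Rightarrow> (component \<Rightarrow> nat) \<Rightarrow> nat \<Rightarrow> nat endpoint set" where
  "ends D s i = (\<Union>c\<in>{c\<in>components D. s c = i}. set (word D c))"

text \<open>
  A labelling \<open>s\<close> groups the skeleton components into families, one for each component of a
  cobordism surface; \<open>glk\<close> is the linking number of two such families.
\<close>

definition glk :: "gauss_diagram \<Rightarrow> (component \<Rightarrow> nat) \<Rightarrow> nat \<Rightarrow> nat \<Rightarrow> int" where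
  "glk D s i j = (\<Sum>a\<in>{a. Tail a \<in> ends D s i \<and> Head a \<in> ends D s j}. writhe D a)"

lemma ends_subset: "ends D s i \<subseteq> endpoints D"
  by (auto simp: ends_def endpoints_def)

lemma ends_label_cong:
  assumes "\<And>c. c \<in> components D \<Longrightarrow> s' c = s c"
  shows "ends D s' i = ends D s i"
  using assms by (auto simp: ends_def)

lemma finite_linking:
  assumes "wf_gauss D"
  shows "finite {a. Tail a \<in> ends D s i \<and> Head a \<in> ends D s j}"
  by (rule finite_subset[OF _ finite_arrows[OF assms]])
     (use ends_subset in_arrows_iff[OF assms] in blast)

lemma same_component_ends:
  assumes "wf_gauss D" "same_component D p q"
  shows "p \<in> ends D s i \<longleftrightarrow> q \<in> ends D s i"
  using assms unfolding same_component_def ends_def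
  by simp (metis wf_gauss_unique_component)

lemma ends_disjoint:
  assumes "wf_gauss D" "p \<in> ends D s i" "p \<in> ends D s j"
  shows "i = j"
  using assms wf_gauss_unique_component unfolding ends_def by fastforce

lemma glk_cong:
  assumes "ends E s' i = ends D s i" "ends E s' j = ends D s j" "writhe E = writhe D"
  shows "glk E s' i j = glk D s i j"
  using assms by (simp add: glk_def)

lemma glk_exchange:
  assumes "wf_gauss D" "same_component D p q"
  shows "glk (exchange p q D) s i j = glk D s i j"
proof (rule glk_cong)
  have "ends (exchange p q D) s i = ends D s i" for i
    by (simp add: ends_def set_word_exchange[OF assms])
  then show "ends (exchange p q D) s i = ends D s i" "ends (exchange p q D) s j = ends D s j"
    by blast+
qed simp

lemma ends_delete_arrows:
  "ends (delete_arrows A D) s i = {p \<in> ends D s i. arrow_of p \<notin> A}"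
  by (auto simp: ends_def)

lemma glk_delete_arrows:
  "glk (delete_arrows A D) s i j =
     (\<Sum>a\<in>{a. Tail a \<in> ends D s i \<and> Head a \<in> ends D s j} - A. writhe D a)"
  unfolding glk_def ends_delete_arrows by (rule sum.cong) auto

text \<open>The two ends of the arrow lie in one family, so the arrow contributes only to the
  linking of that family with itself. This is where \<open>i \<noteq> j\<close> enters.\<close>

lemma glk_rm1_delete:
  assumes "wf_gauss D" "rm1_delete D E" "i \<noteq> j"
  shows "glk E s i j = glk D s i j"
proof -
  obtain a where a: "same_component D (Tail a) (Head a)" and E: "E = delete_arrows {a} D"
    using assms(2) adjacent_same_component unfolding rm1_delete_def by blast
  have "a \<notin> {a. Tail a \<in> ends D s i \<and> Head a \<in> ends D s j}"
    using same_component_ends[OF assms(1) a] ends_disjoint[OF assms(1)] assms(3) by blast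
  then show ?thesis
    unfolding E glk_delete_arrows by (simp add: glk_def)
qed

text \<open>The tails share a component and so do the heads, hence the two arrows are counted
  together or not at all; when counted, their signs cancel.\<close>

lemma glk_rm2_delete:
  assumes "wf_gauss D" "rm2_delete D E"
  shows "glk E s i j = glk D s i j"
proof -
  obtain a b where ab: "a \<noteq> b" "writhe D a = - writhe D b"
    and tails: "same_component D (Tail a) (Tail b)"
    and heads: "same_component D (Head a) (Head b)"
    and E: "E = delete_arrows {a, b} D"
    using assms(2) adjacent_same_component unfolding rm2_delete_def by blast
  let ?S = "{a. Tail a \<in> ends D s i \<and> Head a \<in> ends D s j}"
  have "a \<in> ?S \<longleftrightarrow> b \<in> ?S"
    using same_component_ends[OF assms(1) tails] same_component_ends[OF assms(1) heads] by blast
  moreover have "sum (writhe D) (?S - {a, b}) = sum (writhe D) ?S" if "a \<in> ?S" "b \<in> ?S"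
  proof -
    have "sum (writhe D) ?S = sum (writhe D) (?S - {a, b}) + sum (writhe D) {a, b}"
      using that by (intro sum.subset_diff finite_linking assms(1)) blast
    then show ?thesis using ab by simp
  qed
  ultimately show ?thesis
    unfolding E glk_delete_arrows by (cases "a \<in> ?S") (auto simp: glk_def)
qed

lemma glk_rm3:
  assumes "wf_gauss D" "rm3 D E"
  shows "glk E s i j = glk D s i j"
proof -
  obtain x y z where
    t: "same_component D (Tail x) (Tail y)" and
    m: "same_component D (Head x) (Tail z)" and
    b: "same_component D (Head y) (Head z)" and
    E: "E = exchange (Tail x) (Tail y)
              (exchange (Head x) (Tail z) (exchange (Head y) (Head z) D))"
    using assms(2) consec_sgn_same_component unfolding rm3_def by blast
  let ?D1 = "exchange (Head y) (Head z) D"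
  let ?D2 = "exchange (Head x) (Tail z) ?D1"
  have wf1: "wf_gauss ?D1" by (rule wf_exchange[OF assms(1) b])
  have m1: "same_component ?D1 (Head x) (Tail z)" and t1: "same_component ?D1 (Tail x) (Tail y)"
    using m t same_component_exchange[OF assms(1) b] by blast+
  have wf2: "wf_gauss ?D2" by (rule wf_exchange[OF wf1 m1])
  have t2: "same_component ?D2 (Tail x) (Tail y)"
    using t1 same_component_exchange[OF wf1 m1] by blast
  show ?thesis
    unfolding E glk_exchange[OF wf2 t2] glk_exchange[OF wf1 m1] glk_exchange[OF assms(1) b] ..
qed

lemma glk_reidemeister:
  assumes "wf_gauss D" "wf_gauss E" "reidemeister D E" "i \<noteq> j"
  shows "glk E s i j = glk D s i j"
  using assms glk_rm1_delete glk_rm2_delete glk_rm3 unfolding reidemeister_def by metis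

lemma reidemeister_components:
  "reidemeister D E \<Longrightarrow> strands E = strands D \<and> circs E = circs D"
  unfolding reidemeister_def rm1_delete_def rm2_delete_def rm3_def by auto

lemma glk_isotopy:
  assumes wf: "wf_gauss D" and iso: "isotopy \<pi> D E"
    and strands: "\<And>i. i \<in> {1..strands D} \<Longrightarrow> s' (Strand i) = s (Strand i)"
    and circs: "\<And>k. k \<in> circs D \<Longrightarrow> s' (Circle (\<pi> k)) = s (Circle k)"
  shows "glk E s' i j = glk D s i j"
proof -
  obtain f where f: "inj_on f (arrows D)" "\<And>a. a \<in> arrows D \<Longrightarrow> writhe E (f a) = writhe D a"
    and sE: "strands E = strands D" and \<pi>: "bij_betw \<pi> (circs D) (circs E)"
    and wS: "\<And>i. i \<in> {1..strands D} \<Longrightarrow>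
               word E (Strand i) = map (map_endpoint f) (word D (Strand i))"
    and wC: "\<And>k. k \<in> circs D \<Longrightarrow>
               \<exists>r. word E (Circle (\<pi> k)) = rotate r (map (map_endpoint f) (word D (Circle k)))"
    using iso unfolding isotopy_def by metis
  define h where "h c = (case c of Strand i \<Rightarrow> Strand i | Circle k \<Rightarrow> Circle (\<pi> k))" for c
  have comp: "components E = h ` components D"
    by (simp add: components_def h_def sE image_Un image_image
        flip: bij_betw_imp_surj_on[OF \<pi>])
  have sh: "s' (h c) = s c" if "c \<in> components D" for c
    using that strands circs by (cases c) (auto simp: h_def)
  have wh: "set (word E (h c)) = map_endpoint f ` set (word D c)" if c: "c \<in> components D" for c
  proof (cases c)
    case (Circle k)
    then obtain r where "word E (Circle (\<pi> k)) = rotate r (map (map_endpoint f) (word D c))"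
      using c wC[of k] by auto
    then show ?thesis using Circle by (simp add: h_def)
  qed (use c wS in \<open>simp add: h_def\<close>)
  have ends: "ends E s' i = map_endpoint f ` ends D s i" for i
  proof -
    have "{c \<in> components E. s' c = i} = h ` {c \<in> components D. s c = i}"
      unfolding comp using sh by auto
    then have "ends E s' i = (\<Union>c\<in>{c \<in> components D. s c = i}. set (word E (h c)))"
      by (simp add: ends_def)
    also have "\<dots> = (\<Union>c\<in>{c \<in> components D. s c = i}. map_endpoint f ` set (word D c))"
      using wh by (intro SUP_cong) auto
    finally show ?thesis by (simp add: ends_def image_UN)
  qed
  let ?S = "{a. Tail a \<in> ends D s i \<and> Head a \<in> ends D s j}"
  have sub: "ends D s i \<subseteq> Tail ` arrows D \<union> Head ` arrows D" for i
  proof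
    fix p assume "p \<in> ends D s i"
    then have "arrow_of p \<in> arrows D" using ends_subset by (fastforce simp: arrows_def)
    then show "p \<in> Tail ` arrows D \<union> Head ` arrows D" by (cases p) auto
  qed
  have "{a. Tail a \<in> ends E s' i \<and> Head a \<in> ends E s' j} = f ` ?S" (is "?T = _")
  proof
    show "?T \<subseteq> f ` ?S"
    proof
      fix b assume "b \<in> ?T"
      then obtain p q where p: "p \<in> ends D s i" "Tail b = map_endpoint f p"
        and q: "q \<in> ends D s j" "Head b = map_endpoint f q"
        unfolding ends by blast
      then obtain a a' where a: "p = Tail a" "b = f a" and a': "q = Head a'" "b = f a'"
        by (cases p; cases q) auto
      then have "a \<in> arrows D" "a' \<in> arrows D" using p q sub by auto
      \<comment> \<open>The tail and the head of \<open>b\<close> are a priori images of ends of two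
        different arrows; injectivity of \<open>f\<close> makes them the two ends of one
        arrow.\<close>
      then have "a = a'" using f(1) a a' by (auto dest: inj_onD)
      then show "b \<in> f ` ?S" using a a' p q by auto
    qed
    show "f ` ?S \<subseteq> ?T" unfolding ends by force
  qed
  moreover have S: "?S \<subseteq> arrows D"
    using sub by auto
  moreover have "sum (writhe E) (f ` ?S) = sum (writhe D) ?S"
    using S f by (subst sum.reindex) (auto intro!: sum.cong inj_on_subset[OF f(1)])
  ultimately show ?thesis by (simp add: glk_def)
qed

text \<open>Strands are numbered from 1, so the label 0 keeps all circles out of the linking numbers
  of strands.\<close>

definition strand_label :: "component \<Rightarrow> nat" where
  "strand_label c = (case c of Strand i \<Rightarrow> i | Circle k \<Rightarrow> 0)"

lemma lk_eq_glk:
  assumes "i \<in> {1..strands D}" "j \<in> {1..strands D}"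
    and "\<And>k. k \<in> {1..strands D} \<Longrightarrow> s (Strand k) = k"
    and "\<And>k. k \<in> circs D \<Longrightarrow> s (Circle k) \<notin> {i, j}"
  shows "lk D i j = glk D s i j"
proof -
  have "ends D s k = set (word D (Strand k))" if "k \<in> {i, j}" for k
  proof -
    have "{c \<in> components D. s c = k} = {Strand k}"
      using assms that by (auto simp: components_def)
    then show ?thesis by (simp add: ends_def)
  qed
  then show ?thesis by (simp add: lk_def glk_def)
qed

lemma glk_unwelded_step:
  assumes "unwelded_step D E" "i \<noteq> j"
  shows "strands E = strands D \<and> glk E strand_label i j = glk D strand_label i j"
proof -
  have wf: "wf_gauss D" "wf_gauss E"
    and "(\<exists>\<pi>. isotopy \<pi> D E) \<or> reidemeister D E \<or>
         (\<exists>p q. same_component D p q \<and> E = exchange p q D)"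
    using assms(1) adjacent_same_component
    unfolding unwelded_step_def forbidden1_def forbidden2_def by blast+
  then consider \<pi> where "isotopy \<pi> D E" | "reidemeister D E"
    | p q where "same_component D p q" "E = exchange p q D" by blast
  then show ?thesis
  proof cases
    case 1
    then show ?thesis
      using glk_isotopy[OF wf(1) 1, of strand_label strand_label]
      by (auto simp: isotopy_def strand_label_def)
  qed (use wf assms glk_reidemeister reidemeister_components glk_exchange in auto)
qed

lemma unwelded_equivalent_lk:
  assumes "unwelded_equivalent D E" "i \<in> {1..strands D}" "j \<in> {1..strands D}" "i \<noteq> j"
  shows "lk E i j = lk D i j"
proof -
  have "strands E = strands D \<and> glk E strand_label i j = glk D strand_label i j"
    using assms(1) unfolding unwelded_equivalent_def
  proof (induction rule: rtranclp_induct)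
    case (step E F)
    then show ?case using glk_unwelded_step[OF step(2) assms(4)] by auto
  qed simp
  then show ?thesis
    using assms lk_eq_glk[of i D j strand_label] lk_eq_glk[of i E j strand_label]
    by (simp add: strand_label_def)
qed

section \<open>Invariance under cobordism\<close>

lemma cob_step_strands: "cob_step D R E \<Longrightarrow> strands E = strands D"
  by (induction rule: cob_step.induct)
     (auto simp: isotopy_def saddle_split_def saddle_strands_def dest: reidemeister_components)

text \<open>A strand is named after its initial point, which no saddle cuts away. The vertical sheet
  over that point carries the number of the strand through all levels.\<close>

lemma cob_step_Strand:
  "cob_step D R E \<Longrightarrow> i \<in> {1..strands D} \<Longrightarrow> (Strand i, Strand i) \<in> R"
  by (induction rule: cob_step.induct)
     (auto simp: saddle_split_def Id_on_def)

text \<open>A split distributes the endpoints of \<open>c\<close> over \<open>c\<close> and the new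
  circle. As both carry the same label, the union over each family is unchanged. Read backwards,
  this also covers merging.\<close>

lemma ends_saddle_split:
  assumes "saddle_split c k D E" "s' (Circle k) = s c"
    and same: "\<And>d. d \<in> components D \<Longrightarrow> s' d = s d"
  shows "ends E s' i = ends D s i" "writhe E = writhe D"
proof -
  obtain u v w where c: "c \<in> components D" and k: "k \<notin> circs D" and w: "word D c = u @ v @ w"
    and E: "E = D\<lparr>circs := insert k (circs D), word := (word D)(c := u @ w, Circle k := v)\<rparr>"
    using assms(1) unfolding saddle_split_def by blast
  show "writhe E = writhe D" by (simp add: E)
  have comp: "components E = insert (Circle k) (components D)"
    by (auto simp: E components_def)
  have ne: "d \<noteq> Circle k" if "d \<in> components D" for d using that k by auto
  have wE: "set (word E d) = (if d = c then set (u @ w) else set (word D d))"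
    if "d \<in> components D" for d
    using ne[OF that] by (auto simp: E)
  have wk: "set (word E (Circle k)) = set v" by (simp add: E)
  show "ends E s' i = ends D s i"
  proof (intro equalityI subsetI)
    fix p assume "p \<in> ends E s' i"
    then show "p \<in> ends D s i"
      unfolding ends_def comp using wE wk same c assms(2) w by (auto split: if_splits)
  next
    fix p assume "p \<in> ends D s i"
    then obtain d where d: "d \<in> components D" "s d = i" "p \<in> set (word D d)"
      by (auto simp: ends_def)
    show "p \<in> ends E s' i"
    proof (cases "d = c \<and> p \<in> set v")
      case True
      then show ?thesis unfolding ends_def comp using d wk assms(2) by auto
    next
      case False
      then have "p \<in> set (word E d)" using d wE w by auto
      then show ?thesis unfolding ends_def comp using d same by auto
    qed
  qed
qed

text \<open>With labels that agree along \<open>R\<close>, a birth or death adds or removes only an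
  empty word, and a saddle moves endpoints only between components of the same family.\<close>

lemma glk_cob_step:
  assumes wf: "wf_gauss D" "wf_gauss E" and step: "cob_step D R E"
    and s: "\<And>c c'. (c, c') \<in> R \<Longrightarrow> s' c' = s c" and "i \<noteq> j"
  shows "glk E s' i j = glk D s i j"
  using step
proof cases
  case (cob_isotopy \<pi>)
  then show ?thesis using s by (intro glk_isotopy[OF wf(1)]) auto
next
  case cob_reidemeister
  have comp: "components E = components D"
    using cob_reidemeister by (simp add: components_def reidemeister_components)
  have lab: "s' d = s d" if "d \<in> components D" for d using that s cob_reidemeister by blast
  have "ends E s' k = ends E s k" for k
    by (rule ends_label_cong) (use comp lab in simp)
  then show ?thesis
    using glk_reidemeister[OF wf cob_reidemeister(2) assms(5), of s] by (simp add: glk_def)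
next
  case (cob_birth k)
  have comp: "components E = insert (Circle k) (components D)"
    using cob_birth by (auto simp: components_def)
  have lab: "s' d = s d" if "d \<in> components D" for d using that s cob_birth by blast
  have "d \<noteq> Circle k" if "d \<in> components D" for d using that cob_birth by auto
  then have wE: "word E d = word D d" if "d \<in> components D" for d using that cob_birth by simp
  have wk: "word E (Circle k) = []" using cob_birth by simp
  have "ends E s' i = ends D s i" for i
    unfolding ends_def comp using lab wE wk by auto
  then show ?thesis using cob_birth by (intro glk_cong) auto
next
  case (cob_death k)
  have comp: "components E = components D - {Circle k}"
    using cob_death by (auto simp: components_def)
  have lab: "s' d = s d" if "d \<in> components D - {Circle k}" for d using that s cob_death by blast
  have wE: "word E = word D" using cob_death by simp
  \<comment> \<open>The dying circle may carry any label, but its word is empty. Families are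
    therefore compared after discarding the components with empty words.\<close>
  have "{c. (c \<in> components E \<and> s' c = i) \<and> word D c \<noteq> []} =
      {c. (c \<in> components D \<and> s c = i) \<and> word D c \<noteq> []}" for i
    unfolding comp using lab cob_death(4) by force
  moreover have "ends F r i = (\<Union>c\<in>{c. (c \<in> components F \<and> r c = i) \<and> word F c \<noteq> []}. set (word F c))"
    for F r i by (auto simp: ends_def intro: list.set_cases)
  ultimately have "ends E s' i = ends D s i" for i
    by (simp add: wE)
  then show ?thesis using cob_death by (intro glk_cong) auto
next
  case (cob_split c k)
  have "s' (Circle k) = s c" "\<And>d. d \<in> components D \<Longrightarrow> s' d = s d"
    using s cob_split(1) by blast+
  then show ?thesis by (intro glk_cong ends_saddle_split[OF cob_split(2)])
next
  case (cob_merge c k)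
  have "s (Circle k) = s' c" "\<And>d. d \<in> components E \<Longrightarrow> s d = s' d"
    using s cob_merge(1) by (metis Id_onI insertI1 insertI2)+
  then have "glk D s i j = glk E s' i j"
    by (intro glk_cong ends_saddle_split[OF cob_merge(2)])
  then show ?thesis ..
next
  case (cob_strands a b)
  obtain u v u' v' where ab: "a \<in> {1..strands D}" "b \<in> {1..strands D}" "a \<noteq> b"
    and w: "word D (Strand a) = u @ v" "word D (Strand b) = u' @ v'"
    and E: "E = D\<lparr>word := (word D)(Strand a := u @ v', Strand b := u' @ v)\<rparr>"
    using cob_strands(2) unfolding saddle_strands_def by blast
  have comp: "components E = components D" by (simp add: E components_def)
  have lab: "s' c = s c" if "c \<in> components D" for c using that s cob_strands by blast
  \<comment> \<open>The crossed pairs in \<open>R\<close> put both strands into one family, so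
    interchanging their final parts does not change what the family contains.\<close>
  have "s' (Strand a) = s (Strand b)" using s cob_strands by auto
  then have "s (Strand a) = s (Strand b)" using lab ab by simp
  then have pair: "ends F s k = (\<Union>c\<in>{c \<in> components D - {Strand a, Strand b}. s c = k}. set (word F c)) \<union>
      (if s (Strand a) = k then set (word F (Strand a)) \<union> set (word F (Strand b)) else {})"
    if "components F = components D" for F k
  proof -
    have "Strand a \<in> components D" "Strand b \<in> components D" using ab by simp_all
    then show ?thesis
      unfolding ends_def that using \<open>s (Strand a) = s (Strand b)\<close>
      by (auto split: if_splits simp del: Strand_in_components)
  qed
  have "ends E s k = ends D s k" for k
  proof -
    have "set (word E (Strand a)) \<union> set (word E (Strand b)) =
        set (word D (Strand a)) \<union> set (word D (Strand b))"
      using w ab(3) by (auto simp: E)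
    moreover have "word E c = word D c" if "c \<notin> {Strand a, Strand b}" for c
      using that by (simp add: E)
    then have "(\<Union>c\<in>{c \<in> components D - {Strand a, Strand b}. s c = k}. set (word E c)) =
        (\<Union>c\<in>{c \<in> components D - {Strand a, Strand b}. s c = k}. set (word D c))"
      by (intro SUP_cong) auto
    ultimately show ?thesis
      unfolding pair[OF comp] pair[OF refl] by presburger
  qed
  moreover have "ends E s' k = ends E s k" for k
    by (rule ends_label_cong) (use comp lab in simp)
  ultimately show ?thesis by (intro glk_cong) (auto simp: E)
qed

text \<open>Each component of the diagram at level \<open>t\<close> is labelled by the initial
  strand on its piece of surface. At both ends of the movie this labelling gives strand
  \<open>k\<close> the label \<open>k\<close>, so the preserved quantity is the ordinary linking
  number there.\<close>

lemma cobordant_lk: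
  assumes "cobordant n L L'" "virtual_string_link n L" "virtual_string_link n L'"
    and ij: "i \<in> {1..n}" "j \<in> {1..n}" "i \<noteq> j"
  shows "lk L' i j = lk L i j"
proof -
  obtain m D R where *: "D 0 = L \<and> D m = L' \<and> movie m D R \<and>
      card (surface_components m D R) = n \<and>
      (\<forall>K\<in>surface_components m D R.
         (\<exists>!i. i \<in> {1..n} \<and> (0, Strand i) \<in> K) \<and> (\<exists>!i. i \<in> {1..n} \<and> (m, Strand i) \<in> K))"
    using assms(1) unfolding cobordant_def by (elim exE) (rule that)
  note ends = *[THEN conjunct1] *[THEN conjunct2, THEN conjunct1]
    and mov = *[THEN conjunct2, THEN conjunct2, THEN conjunct1]
  have unique: "\<exists>!i. i \<in> {1..n} \<and> (0, Strand i) \<in> K" if "K \<in> surface_components m D R" for K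
    by (rule *[THEN conjunct2, THEN conjunct2, THEN conjunct2, THEN conjunct2, THEN bspec, OF that,
        THEN conjunct1])
  define J where "J = (joined m R \<union> (joined m R)\<inverse>)\<^sup>*"
  have equiv: "J `` {x} = J `` {y}" if "(x, y) \<in> joined m R" for x y
  proof -
    have "equiv UNIV J"
      unfolding J_def equiv_def
      by (auto simp: refl_rtrancl trans_rtrancl intro: sym_rtrancl symI)
    moreover have "(x, y) \<in> J" using that unfolding J_def by blast
    ultimately show ?thesis by (rule equiv_class_eq)
  qed
  have strands: "strands (D t) = n" if "t \<le> m" for t
    using that
  proof (induction t)
    case 0
    then show ?case using assms(2) ends by (simp add: virtual_string_link_def)
  next
    case (Suc t)
    then show ?case using mov cob_step_strands[of "D t" "R t" "D (Suc t)"]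
      by (simp add: movie_def)
  qed
  \<comment> \<open>The label depends on the equivalence class alone, so it agrees along
    \<open>R\<close> by construction. Uniqueness of the initial strand serves to evaluate it at
    level 0.\<close>
  define s where "s t c = (THE i. i \<in> {1..n} \<and> (0, Strand i) \<in> J `` {(t, c)})" for t c
  have s_R: "s (Suc t) c' = s t c" if "(c, c') \<in> R t" "t < m" for t c c'
    unfolding s_def using equiv[of "(t, c)" "(Suc t, c')"] that by (auto simp: joined_def)
  have s0: "s 0 (Strand k) = k" if "k \<in> {1..n}" for k
  proof -
    have "J `` {(0, Strand k)} \<in> surface_components m D R"
      unfolding surface_components_def J_def
      by (rule quotientI) (use strands[of 0] that in \<open>auto simp: levels_def\<close>)
    from unique[OF this] show ?thesis
      unfolding s_def using that by (intro the1_equality) (auto simp: J_def)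
  qed
  have inv: "(\<forall>k\<in>{1..n}. s t (Strand k) = k) \<and> glk (D t) (s t) i j = glk L (s 0) i j"
    if "t \<le> m" for t
    using that
  proof (induction t)
    case 0
    then show ?case using s0 ends by simp
  next
    case (Suc t)
    then have step: "cob_step (D t) (R t) (D (Suc t))"
      and wf: "wf_gauss (D t)" "wf_gauss (D (Suc t))"
      using mov by (auto simp: movie_def)
    moreover have "s (Suc t) (Strand k) = s t (Strand k)" if "k \<in> {1..n}" for k
      using s_R[of "Strand k" "Strand k" t] cob_step_Strand[OF step] strands[of t] that Suc by simp
    moreover have "glk (D (Suc t)) (s (Suc t)) i j = glk (D t) (s t) i j"
      using wf step s_R[of _ _ t] Suc ij(3) by (intro glk_cob_step) auto
    ultimately show ?case using Suc by simp
  qed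
  have "lk L i j = glk L (s 0) i j" "lk L' i j = glk L' (s m) i j"
    using inv[of 0] inv[of m] assms by (auto intro!: lk_eq_glk simp: virtual_string_link_def)
  then show ?thesis using inv[of m] ends by simp
qed

section \<open>Forbidden moves exchange a head with a tail\<close>

text \<open>Used to identify diagrams whose records differ only in words of absent components or in
  writhes of absent arrows.\<close>

lemma isotopy_id:
  assumes "strands E = strands D" "circs E = circs D"
    and "\<And>c. c \<in> components D \<Longrightarrow> word E c = word D c"
    and "\<And>a. a \<in> arrows D \<Longrightarrow> writhe E a = writhe D a"
  shows "isotopy id D E"
  unfolding isotopy_def
proof (intro conjI exI[of _ id] ballI)
  fix k assume "k \<in> circs D"
  then show "\<exists>r. word E (Circle (id k)) = rotate r (map (map_endpoint id) (word D (Circle k)))"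
    using assms(3)[of "Circle k"] by (intro exI[of _ 0]) (simp add: endpoint.map_id0)
qed (use assms in \<open>auto simp: endpoint.map_id0\<close>)

text \<open>An exchange renames endpoints throughout the diagram, so arcs are carried to arcs by the
  same transposition. Adjacency after several moves can thus be computed by rewriting names instead
  of tracking positions in words.\<close>

lemma consec_exchange:
  assumes "consec D a b"
  shows "consec (exchange p q D) ((id(p := q, q := p)) a) ((id(p := q, q := p)) b)"
  using assms unfolding consec_def exchange_simps word_exchange
proof (elim disjE bexE exE)
  fix c u v
  assume "c \<in> components D" "word D c = u @ a # b # v"
  then show "(\<exists>c\<in>components D. \<exists>u v. map (id(p := q, q := p)) (word D c) =
        u @ (id(p := q, q := p)) a # (id(p := q, q := p)) b # v) \<or>
      (\<exists>k\<in>circs D. \<exists>u. map (id(p := q, q := p)) (word D (Circle k)) =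
        (id(p := q, q := p)) b # u @ [(id(p := q, q := p)) a])"
    by (intro disjI1 bexI[of _ c] exI[of _ "map (id(p := q, q := p)) u"]
        exI[of _ "map (id(p := q, q := p)) v"]) (simp_all only: map_append list.map)
next
  fix k u
  assume "k \<in> circs D" "word D (Circle k) = b # u @ [a]"
  then show "(\<exists>c\<in>components D. \<exists>u v. map (id(p := q, q := p)) (word D c) =
        u @ (id(p := q, q := p)) a # (id(p := q, q := p)) b # v) \<or>
      (\<exists>k\<in>circs D. \<exists>u. map (id(p := q, q := p)) (word D (Circle k)) =
        (id(p := q, q := p)) b # u @ [(id(p := q, q := p)) a])"
    by (intro disjI2 bexI[of _ k] exI[of _ "map (id(p := q, q := p)) u"])
       (simp_all only: map_append list.map)
qed

lemma adjacent_exchange: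
  "adjacent D a b \<Longrightarrow>
    adjacent (exchange p q D) ((id(p := q, q := p)) a) ((id(p := q, q := p)) b)"
  unfolding adjacent_def using consec_exchange by blast

lemma adjacent_sym: "adjacent D p q \<longleftrightarrow> adjacent D q p"
  by (auto simp: adjacent_def)

lemma exchange_sym: "exchange p q D = exchange q p D"
proof -
  have "id(p := q, q := p) = id(q := p, p := q)" by auto
  then show ?thesis by (simp only: exchange_def)
qed

lemma exchange_exchange [simp]: "exchange p q (exchange p q D) = D"
proof -
  have "id(p := q, q := p) \<circ> id(p := q, q := p) = id" by auto
  then show ?thesis by (simp add: exchange_def del: fun_upd_apply)
qed

lemma adjacent_exchanged: "adjacent D p q \<Longrightarrow> adjacent (exchange p q D) p q"
  using adjacent_exchange[of D q p p q] by (simp add: adjacent_sym split: if_splits)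

section \<open>Inserting arrows next to given endpoints\<close>

text \<open>Replacing each endpoint by a block inserts new endpoints beside old ones wherever these
  lie, on a strand or across the base point of a circle, without naming a position in a
  word.\<close>

definition substitute ::
    "(nat endpoint \<Rightarrow> nat endpoint list) \<Rightarrow> (nat \<Rightarrow> int) \<Rightarrow> gauss_diagram \<Rightarrow> gauss_diagram" where
  "substitute g w D =
     D\<lparr>word := \<lambda>c. if c \<in> components D then concat (map g (word D c)) else [], writhe := w\<rparr>"

lemma substitute_simps [simp]:
  "strands (substitute g w D) = strands D" "circs (substitute g w D) = circs D"
  "writhe (substitute g w D) = w" "components (substitute g w D) = components D"
  "c \<in> components D \<Longrightarrow> word (substitute g w D) c = concat (map g (word D c))"
  by (simp_all add: substitute_def components_def)

lemma endpoints_substitute: "endpoints (substitute g w D) = (\<Union>p\<in>endpoints D. set (g p))"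
  by (simp add: endpoints_def)

lemma wf_substitute:
  assumes wf: "wf_gauss D"
    and dist: "\<And>p. p \<in> endpoints D \<Longrightarrow> distinct (g p)"
    and disj: "\<And>p q. p \<in> endpoints D \<Longrightarrow> q \<in> endpoints D \<Longrightarrow> p \<noteq> q \<Longrightarrow> set (g p) \<inter> set (g q) = {}"
    and arr: "\<And>a. a \<in> arrows (substitute g w D) \<Longrightarrow> Tail a \<in> endpoints (substitute g w D) \<and>
        Head a \<in> endpoints (substitute g w D) \<and> w a \<in> {1, -1}"
  shows "wf_gauss (substitute g w D)"
proof -
  let ?E = "substitute g w D"
  have sub: "set (word D c) \<subseteq> endpoints D" if "c \<in> components D" for c
    using that by (auto simp: endpoints_def)
  have 1: "distinct (word ?E c)" if c: "c \<in> components D" for c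
  proof -
    have "distinct (concat (map g xs))" if "distinct xs" "set xs \<subseteq> endpoints D" for xs
      using that
    proof (induction xs)
      case (Cons p xs)
      then have "set (g p) \<inter> set (g q) = {}" if "q \<in> set xs" for q
        using that by (intro disj) auto
      with Cons dist show ?case by auto
    qed simp
    then show ?thesis using c sub wf_gauss_distinct[OF wf c] by simp
  qed
  have 2: "set (word ?E c) \<inter> set (word ?E c') = {}"
    if c: "c \<in> components D" "c' \<in> components D" "c \<noteq> c'" for c c'
  proof -
    have "set (g p) \<inter> set (g q) = {}" if "p \<in> set (word D c)" "q \<in> set (word D c')" for p q
    proof (rule disj)
      show "p \<noteq> q" using wf_gauss_unique_component[OF wf c(1,2)] that c(3) by blast
    qed (use that c sub in blast)+
    then show ?thesis using c by auto
  qed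
  have "finite (circs D)" using wf by (simp add: wf_gauss_def)
  with 1 2 arr show ?thesis
    unfolding wf_gauss_def substitute_simps(2-4) by blast
qed

lemma consec_substitute:
  assumes "consec D p q" "g p = [p]" "g q = [q]"
  shows "consec (substitute g w D) p q"
  using assms(1) unfolding consec_def
proof (elim disjE bexE exE)
  fix c u v assume c: "c \<in> components D" and "word D c = u @ p # q # v"
  then have "word (substitute g w D) c = concat (map g u) @ p # q # concat (map g v)"
    using assms(2,3) by simp
  with c show "(\<exists>c\<in>components (substitute g w D). \<exists>u v. word (substitute g w D) c = u @ p # q # v) \<or>
      (\<exists>k\<in>circs (substitute g w D). \<exists>u. word (substitute g w D) (Circle k) = q # u @ [p])"
    by (intro disjI1 bexI[of _ c]) auto
next
  fix k u assume k: "k \<in> circs D" and "word D (Circle k) = q # u @ [p]"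
  then have "word (substitute g w D) (Circle k) = q # concat (map g u) @ [p]"
    using assms(2,3) by simp
  with k show "(\<exists>c\<in>components (substitute g w D). \<exists>u v. word (substitute g w D) c = u @ p # q # v) \<or>
      (\<exists>k\<in>circs (substitute g w D). \<exists>u. word (substitute g w D) (Circle k) = q # u @ [p])"
    by (intro disjI2 bexI[of _ k]) auto
qed

lemma consec_substitute_block:
  assumes "p \<in> endpoints D" "g p = u @ a # b # v"
  shows "consec (substitute g w D) a b"
proof -
  obtain c u' v' where c: "c \<in> components D" and "word D c = u' @ p # v'"
    using assms(1) unfolding endpoints_def by (auto dest: split_list)
  then have "word (substitute g w D) c = (concat (map g u') @ u) @ a # b # (v @ concat (map g v'))"
    using assms(2) by simp
  with c show ?thesis unfolding consec_def substitute_simps(4) by blast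
qed

text \<open>
  Add two cancelling arrows \<open>y\<close>, \<open>y'\<close> parallel to the concatenation of \<open>x\<close> and \<open>z\<close>, use RM3 on
  \<open>x\<close>, \<open>y\<close>, \<open>z\<close> to exchange the head of \<open>x\<close> with the tail of \<open>z\<close>, and restore everything else by
  means of the forbidden moves.
\<close>

lemma unwelded_exchange_head_tail:
  assumes wf: "wf_gauss D" and xz: "x \<noteq> z" and em: "\<epsilon>m \<in> {1, -1}"
    and con: "consec_sgn D \<epsilon>m (Head x) (Tail z)"
  shows "unwelded_equivalent D (exchange (Head x) (Tail z) D)"
proof -
  have "\<exists>y. y \<notin> F" if "finite F" for F :: "nat set"
    using ex_new_if_finite[OF infinite_UNIV_nat that] .
  from this[OF finite_arrows[OF wf]] this[of "insert _ (arrows D)"]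
  obtain y y' where y: "y \<notin> arrows D" "y' \<notin> arrows D" "y' \<noteq> y"
    using finite_arrows[OF wf] by (metis finite_insert insertCI)
  have "Head x \<in> endpoints D" "Tail z \<in> endpoints D"
    using consec_sgn_same_component[OF con] by (auto simp: same_component_def endpoints_def)
  then have x: "x \<in> arrows D" and z: "z \<in> arrows D"
    using in_arrows_iff[OF wf] by blast+
  then have Tx: "Tail x \<in> endpoints D" and Hz: "Head z \<in> endpoints D"
    using in_arrows_iff[OF wf] by blast+
  have ne: "x \<noteq> y" "x \<noteq> y'" "z \<noteq> y" "z \<noteq> y'" using x z y by auto
  have signs: "writhe D x \<in> {1, -1}" "writhe D z \<in> {1, -1}"
    using wf x z by (simp_all add: wf_gauss_def)
  \<comment> \<open>The sign conditions of RM3 with \<delta> = 1, solved for the two unknown orders: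
    \<open>\<epsilon>m\<close> is given by the arc through \<open>Head x\<close> and
    \<open>Tail z\<close>, and \<open>\<epsilon>m * \<epsilon>m = 1\<close>. The remaining condition
    prescribes the sign \<open>\<epsilon>t * \<epsilon>b\<close> of \<open>y\<close>.\<close>
  define \<epsilon>t where "\<epsilon>t = writhe D x * \<epsilon>m"
  define \<epsilon>b where "\<epsilon>b = writhe D z * \<epsilon>m"
  have eps: "\<epsilon>t \<in> {1, -1}" "\<epsilon>b \<in> {1, -1}" "writhe D x = \<epsilon>t * \<epsilon>m" "writhe D z = \<epsilon>m * \<epsilon>b"
    using signs em by (auto simp: \<epsilon>t_def \<epsilon>b_def)
  \<comment> \<open>The end of \<open>y\<close> stands directly beside that of \<open>x\<close> or
    \<open>z\<close>, in the order demanded by \<open>\<epsilon>t\<close> or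
    \<open>\<epsilon>b\<close>. The end of \<open>y'\<close> is placed on the far side of
    \<open>y\<close>, outside the arcs on which RM3 acts.\<close>
  define g where "g p = (if p = Tail x then if \<epsilon>t = 1 then [Tail x, Tail y, Tail y']
                                            else [Tail y', Tail y, Tail x]
                         else if p = Head z then if \<epsilon>b = 1 then [Head y', Head y, Head z]
                                            else [Head z, Head y, Head y']
                         else [p])" for p
  define w where "w = (writhe D)(y := \<epsilon>t * \<epsilon>b, y' := - (\<epsilon>t * \<epsilon>b))"
  define D1 where "D1 = substitute g w D"
  have fresh: "Tail y \<notin> endpoints D" "Tail y' \<notin> endpoints D"
      "Head y \<notin> endpoints D" "Head y' \<notin> endpoints D"
    using y in_arrows_iff[OF wf] by blast+
  have set_g: "set (g p) = (if p = Tail x then {p, Tail y, Tail y'}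
      else if p = Head z then {p, Head y, Head y'} else {p})" for p
    by (auto simp: g_def)
  have ep1: "endpoints D1 = endpoints D \<union> {Tail y, Tail y', Head y, Head y'}"
    unfolding D1_def endpoints_substitute set_g using Tx Hz by (auto split: if_splits)
  have ar1: "arrows D1 = arrows D \<union> {y, y'}"
    unfolding arrows_def ep1 by auto
  have wf1: "wf_gauss D1"
    unfolding D1_def
  proof (rule wf_substitute[OF wf])
    show "distinct (g p)" for p using y(3) ne by (auto simp: g_def)
    show "set (g p) \<inter> set (g q) = {}" if "p \<in> endpoints D" "q \<in> endpoints D" "p \<noteq> q" for p q
      unfolding set_g using that fresh by auto
    fix a assume "a \<in> arrows (substitute g w D)"
    then have a: "a \<in> arrows D \<or> a = y \<or> a = y'" using ar1 by (auto simp: D1_def)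
    have "w a \<in> {1, -1}"
    proof (cases "a = y \<or> a = y'")
      case True
      then show ?thesis using eps(1,2) by (auto simp: w_def)
    next
      case False
      then show ?thesis using a wf by (simp add: w_def wf_gauss_def)
    qed
    moreover have "Tail a \<in> endpoints D1 \<and> Head a \<in> endpoints D1"
      unfolding ep1 using a in_arrows_iff[OF wf] by auto
    ultimately show "Tail a \<in> endpoints (substitute g w D) \<and>
        Head a \<in> endpoints (substitute g w D) \<and> w a \<in> {1, -1}"
      by (simp add: D1_def)
  qed
  have gxz: "g (Head x) = [Head x]" "g (Tail z) = [Tail z]" using xz by (auto simp: g_def)
  have c_m: "consec_sgn D1 \<epsilon>m (Head x) (Tail z)"
    using con gxz unfolding consec_sgn_def D1_def by (auto intro: consec_substitute)
  have c_t: "consec_sgn D1 \<epsilon>t (Tail x) (Tail y)" "adjacent D1 (Tail y) (Tail y')"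
    using consec_substitute_block[OF Tx, of g "[]" _ _ "[_]" w]
      consec_substitute_block[OF Tx, of g "[_]" _ _ "[]" w]
    unfolding D1_def consec_sgn_def adjacent_def by (cases "\<epsilon>t = 1"; auto simp: g_def)+
  have c_b: "consec_sgn D1 \<epsilon>b (Head y) (Head z)" "adjacent D1 (Head y) (Head y')"
    using consec_substitute_block[OF Hz, of g "[]" _ _ "[_]" w]
      consec_substitute_block[OF Hz, of g "[_]" _ _ "[]" w]
    unfolding D1_def consec_sgn_def adjacent_def by (cases "\<epsilon>b = 1"; auto simp: g_def)+
  have a1: "adjacent D1 (Tail x) (Tail y)" "adjacent D1 (Head y) (Head z)"
    using c_t c_b unfolding consec_sgn_def adjacent_def by (auto split: if_splits)

  let ?D0 = "delete_arrows {y, y'} D1"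
  define D2b where "D2b = exchange (Head y) (Head z) D1"
  define D2m where "D2m = exchange (Head x) (Tail z) D2b"
  define D2 where "D2 = exchange (Tail x) (Tail y) D2m"
  \<comment> \<open>RM3 leaves \<open>Tail x\<close> between the tails of \<open>y\<close> and
    \<open>y'\<close>, and \<open>Head z\<close> between their heads. One forbidden move on each arc
    makes \<open>y\<close> and \<open>y'\<close> parallel neighbours again, ready for RM2.\<close>
  define D3 where "D3 = exchange (Tail x) (Tail y') D2"
  define D4 where "D4 = exchange (Head z) (Head y') D3"
  let ?D5 = "delete_arrows {y, y'} D4"
  let ?E = "exchange (Head x) (Tail z) D"
  have adj2b: "adjacent D2b (Tail x) (Tail y)" "adjacent D2b (Tail y) (Tail y')"
      "adjacent D2b (Head z) (Head y')"
    using adjacent_exchange[OF a1(1), of "Head y" "Head z"]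
      adjacent_exchange[OF c_t(2), of "Head y" "Head z"]
      adjacent_exchange[OF c_b(2), of "Head y" "Head z"] y(3) ne
    by (simp_all add: D2b_def)
  have adj2m: "adjacent D2m (Tail x) (Tail y)" "adjacent D2m (Tail y) (Tail y')"
      "adjacent D2m (Head z) (Head y')"
    using adj2b[THEN adjacent_exchange, of "Head x" "Tail z"] y(3) ne xz
    by (simp_all add: D2m_def)
  have adj2: "adjacent D2 (Tail x) (Tail y')" "adjacent D2 (Tail y) (Tail x)"
      "adjacent D2 (Head z) (Head y')"
    using adj2m[THEN adjacent_exchange, of "Tail x" "Tail y"] y(3) ne
    by (simp_all add: D2_def)

  have adj3: "adjacent D3 (Tail y) (Tail y')" "adjacent D3 (Head z) (Head y')"
    using adj2(2,3)[THEN adjacent_exchange, of "Tail x" "Tail y'"] y(3) ne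
    by (simp_all add: D3_def)
  have hy: "adjacent D3 (Head y) (Head z)"
  proof -
    have "adjacent D2b (Head y) (Head z)"
      unfolding D2b_def by (rule adjacent_exchanged[OF a1(2)])
    then have "adjacent D2m (Head y) (Head z)"
      using adjacent_exchange[of D2b "Head y" "Head z" "Head x" "Tail z"] ne xz
      by (simp add: D2m_def)
    then show ?thesis
      using adjacent_exchange[of D2m "Head y" "Head z" "Tail x" "Tail y"]
        adjacent_exchange[of D2 "Head y" "Head z" "Tail x" "Tail y'"]
      by (simp add: D2_def D3_def)
  qed
  have adj4: "adjacent D4 (Tail y) (Tail y')" "adjacent D4 (Head y) (Head y')"
    using adjacent_exchange[OF adj3(1), of "Head z" "Head y'"]
      adjacent_exchange[OF hy, of "Head z" "Head y'"] y(3) ne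
    by (simp_all add: D4_def)
  have wf2b: "wf_gauss D2b"
    unfolding D2b_def by (rule wf_exchange[OF wf1 adjacent_same_component[OF a1(2)]])
  have wf2m: "wf_gauss D2m"
    unfolding D2m_def
  proof (rule wf_exchange[OF wf2b])
    show "same_component D2b (Head x) (Tail z)"
      unfolding D2b_def same_component_exchange[OF wf1 adjacent_same_component[OF a1(2)]]
      by (rule consec_sgn_same_component[OF c_m])
  qed
  have wf2: "wf_gauss D2"
    unfolding D2_def by (rule wf_exchange[OF wf2m adjacent_same_component[OF adj2m(1)]])
  have wf3: "wf_gauss D3"
    unfolding D3_def by (rule wf_exchange[OF wf2 adjacent_same_component[OF adj2(1)]])
  have wf4: "wf_gauss D4"
    unfolding D4_def by (rule wf_exchange[OF wf3 adjacent_same_component[OF adj3(2)]])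
  have wfE: "wf_gauss ?E"
    by (rule wf_exchange[OF wf consec_sgn_same_component[OF con]])
  have old: "filter (\<lambda>p. arrow_of p \<notin> {y, y'}) (g p) = [p]" if "p \<in> endpoints D" for p
    using that fresh ne by (cases p) (auto simp: g_def)
  have wr: "writhe D4 = w" "writhe D1 = w"
    by (simp_all add: D4_def D3_def D2_def D2m_def D2b_def D1_def)

  \<comment> \<open>Inserting and deleting \<open>y\<close>, \<open>y'\<close> restores
    \<open>D\<close> only up to data of absent components and arrows, so an identity isotopy
    precedes the insertion by RM2.\<close>
  have "unwelded_step D ?D0"
  proof -
    have "isotopy id D ?D0"
    proof (rule isotopy_id)
      fix c assume c: "c \<in> components D"
      have "concat (map (\<lambda>p. filter (\<lambda>p. arrow_of p \<notin> {y, y'}) (g p)) (word D c)) =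
          concat (map (\<lambda>p. [p]) (word D c))"
        using c old by (intro arg_cong[of _ _ concat] map_cong) (auto simp: endpoints_def)
      then show "word ?D0 c = word D c"
        using c by (simp add: D1_def filter_concat comp_def)
    next
      fix a assume "a \<in> arrows D"
      then show "writhe ?D0 a = writhe D a" using y by (auto simp: wr w_def)
    qed (simp_all add: D1_def)
    then show ?thesis unfolding unwelded_step_def using wf wf1 wf_delete_arrows by blast
  qed
  moreover have "unwelded_step ?D0 D1"
  proof -
    have "rm2_delete D1 ?D0"
      unfolding rm2_delete_def
      by (intro exI[of _ y] exI[of _ y'])
         (use y(3) c_t c_b in \<open>simp add: wr w_def\<close>)
    then show ?thesis
      unfolding unwelded_step_def reidemeister_def using wf1 wf_delete_arrows by blast
  qed
  moreover have "unwelded_step D1 D2"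
  proof -
    have "rm3 D1 D2"
      unfolding rm3_def
    proof (intro exI conjI)
      show "writhe D1 x = 1 * \<epsilon>t * \<epsilon>m" "writhe D1 y = 1 * \<epsilon>t * \<epsilon>b" "writhe D1 z = 1 * \<epsilon>m * \<epsilon>b"
        using eps(3,4) ne y(3) by (simp_all add: wr w_def)
      show "D2 = exchange (Tail x) (Tail y)
          (exchange (Head x) (Tail z) (exchange (Head y) (Head z) D1))"
        by (simp only: D2_def D2m_def D2b_def)
    qed (use xz ne eps em c_m c_t c_b in simp_all)
    then show ?thesis
      unfolding unwelded_step_def reidemeister_def using wf1 wf2 by blast
  qed
  moreover have "unwelded_step D2 D3"
    unfolding unwelded_step_def forbidden1_def D3_def
    using wf2 wf3[unfolded D3_def] adj2(1) by blast
  moreover have "unwelded_step D3 D4"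
    unfolding unwelded_step_def forbidden2_def D4_def
    using wf3 wf4[unfolded D4_def] adj3(2) by blast
  moreover have "unwelded_step D4 ?D5"
  proof -
    have "rm2_delete D4 ?D5"
      unfolding rm2_delete_def
      by (intro exI[of _ y] exI[of _ y'])
         (use y(3) adj4 in \<open>simp add: wr w_def\<close>)
    then show ?thesis
      unfolding unwelded_step_def reidemeister_def using wf4 wf_delete_arrows by blast
  qed
  moreover have "unwelded_step ?D5 ?E"
  proof -
    define sw where "sw p q = id(p := q, q := p)" for p q :: "nat endpoint"
    \<comment> \<open>The composite of the five exchanges. It permutes the three letters of each
      inserted block cyclically, and on the other old endpoints it is the desired transposition.
      Once \<open>y\<close> and \<open>y'\<close> are deleted, each block therefore shrinks back to
      its original endpoint.\<close>
    define S where "S p = sw (Head z) (Head y') (sw (Tail x) (Tail y') (sw (Tail x) (Tail y)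
        (sw (Head x) (Tail z) (sw (Head y) (Head z) p))))" for p
    have block: "filter (\<lambda>p. arrow_of p \<notin> {y, y'}) (map S (g p)) = [sw (Head x) (Tail z) p]"
      if "p \<in> endpoints D" for p
    proof -
      have [simp]: "sw p q r = (if r = q then p else if r = p then q else r)" for p q r
        by (simp add: sw_def)
      have S_new: "S (Tail x) = Tail y" "S (Tail y) = Tail y'" "S (Tail y') = Tail x"
          "S (Head z) = Head y" "S (Head y) = Head y'" "S (Head y') = Head z"
        using ne y(3) xz by (simp_all add: S_def)
      have S_old: "S p = sw (Head x) (Tail z) p" if "p \<noteq> Tail x" "p \<noteq> Head z" "arrow_of p \<notin> {y, y'}"
        using that ne y(3) xz by (cases p) (simp_all add: S_def)
      have p: "arrow_of p \<notin> {y, y'}"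
        using \<open>p \<in> endpoints D\<close> fresh by (cases p) auto
      consider "p = Tail x" | "p = Head z" | "p \<noteq> Tail x" "p \<noteq> Head z" by blast
      then show ?thesis
      proof cases
        case 3
        then have "g p = [p]" by (simp add: g_def)
        with S_old[OF 3 p] p ne show ?thesis by simp
      qed (use ne y(3) xz in \<open>simp_all add: g_def S_new\<close>)
    qed
    have wD5: "word ?D5 c = word ?E c" if c: "c \<in> components D" for c
    proof -
      have "word D4 c = map S (word D1 c)"
        unfolding D4_def D3_def D2_def D2m_def D2b_def word_exchange S_def sw_def
        by (simp del: fun_upd_apply)
      then have "word ?D5 c = concat (map (\<lambda>p. filter (\<lambda>p. arrow_of p \<notin> {y, y'}) (map S (g p))) (word D c))"
        using c by (simp add: D1_def filter_concat map_concat comp_def)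
      also have "\<dots> = concat (map (\<lambda>p. [sw (Head x) (Tail z) p]) (word D c))"
        using c block by (intro arg_cong[of _ _ concat] map_cong) (auto simp: endpoints_def)
      also have "\<dots> = word ?E c"
        unfolding word_exchange sw_def by (rule concat_map_singleton)
      finally show ?thesis .
    qed
    have comp: "components ?D5 = components D" "strands ?D5 = strands D" "circs ?D5 = circs D"
      by (simp_all add: D4_def D3_def D2_def D2m_def D2b_def D1_def)
    have "isotopy id ?D5 ?E"
    proof (rule isotopy_id)
      fix a assume "a \<in> arrows ?D5"
      then have "a \<notin> {y, y'}" by (simp add: arrows_delete_arrows)
      then show "writhe ?E a = writhe ?D5 a" by (simp add: wr w_def)
    qed (use comp wD5 in simp_all)
    then show ?thesis
      unfolding unwelded_step_def using wfE wf4 wf_delete_arrows by blast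
  qed
  ultimately show ?thesis
    unfolding unwelded_equivalent_def
    by (meson converse_rtranclp_into_rtranclp rtranclp.rtrancl_refl)
qed

section \<open>Moves available both for unwelded equivalence and for cobordism\<close>

text \<open>Moves that both relations can simulate and that suffice for the classification by
  linking numbers. Working with them settles both converse implications at once. Creation and
  deletion both occur so that the relation is symmetric.\<close>

definition link_step :: "nat \<Rightarrow> gauss_diagram \<Rightarrow> gauss_diagram \<Rightarrow> bool" where
  "link_step n D E \<longleftrightarrow> virtual_string_link n D \<and> virtual_string_link n E \<and>
     ((\<exists>\<pi>. isotopy \<pi> D E) \<or> (\<exists>p q. adjacent D p q \<and> E = exchange p q D) \<or>
      rm1_delete D E \<or> rm1_delete E D \<or> rm2_delete D E \<or> rm2_delete E D)"

text \<open>The RM3 construction requires two different arrows. When both endpoints belong to one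
  arrow, deleting it by RM1 gives the same diagram before and after the exchange.\<close>

lemma unwelded_exchange_ends:
  assumes adj: "adjacent D (Tail a) (Head a)" and wf: "wf_gauss D"
  shows "unwelded_equivalent D (exchange (Tail a) (Head a) D)"
proof -
  let ?E = "exchange (Tail a) (Head a) D"
  have wfE: "wf_gauss ?E" by (rule wf_exchange[OF wf adjacent_same_component[OF adj]])
  have "delete_arrows {a} ?E = delete_arrows {a} D"
  proof -
    have "filter (\<lambda>p. arrow_of p \<noteq> a) (map (id(Tail a := Head a, Head a := Tail a)) w) =
        filter (\<lambda>p. arrow_of p \<noteq> a) w" for w
      by (induction w) auto
    then show ?thesis by (simp add: delete_arrows_def exchange_def)
  qed
  then have "rm1_delete D (delete_arrows {a} D)" "rm1_delete ?E (delete_arrows {a} D)"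
    unfolding rm1_delete_def using adj adjacent_exchanged[OF adj] by metis+
  then have "unwelded_step D (delete_arrows {a} D)" "unwelded_step (delete_arrows {a} D) ?E"
    unfolding unwelded_step_def reidemeister_def using wf wfE wf_delete_arrows by blast+
  then show ?thesis unfolding unwelded_equivalent_def by (meson r_into_rtranclp rtranclp_trans)
qed

lemma unwelded_exchange:
  assumes wf: "wf_gauss D" and adj: "adjacent D p q"
  shows "unwelded_equivalent D (exchange p q D)"
proof -
  have wfE: "wf_gauss (exchange p q D)"
    by (rule wf_exchange[OF wf adjacent_same_component[OF adj]])
  have ht: "unwelded_equivalent D (exchange (Head x) (Tail z) D)"
    if "adjacent D (Head x) (Tail z)" for x z
  proof (cases "x = z")
    case True
    then show ?thesis
      using unwelded_exchange_ends[of D x] wf that by (simp add: adjacent_sym exchange_sym)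
  next
    case False
    have "consec_sgn D 1 (Head x) (Tail z) \<or> consec_sgn D (-1) (Head x) (Tail z)"
      using that by (auto simp: consec_sgn_def adjacent_def)
    then show ?thesis using unwelded_exchange_head_tail[OF wf False] by blast
  qed
  show ?thesis
  proof (cases p; cases q)
    fix a b assume "p = Tail a" "q = Tail b"
    then have "forbidden1 D (exchange p q D)" using adj unfolding forbidden1_def by blast
    then show ?thesis
      unfolding unwelded_equivalent_def using wf wfE by (auto simp: unwelded_step_def)
  next
    fix a b assume "p = Head a" "q = Head b"
    then have "forbidden2 D (exchange p q D)" using adj unfolding forbidden2_def by blast
    then show ?thesis
      unfolding unwelded_equivalent_def using wf wfE by (auto simp: unwelded_step_def)
  next
    fix a b assume "p = Tail a" "q = Head b"
    then show ?thesis using ht[of b a] adj adjacent_sym exchange_sym by metis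
  next
    fix a b assume "p = Head a" "q = Tail b"
    then show ?thesis using ht adj by blast
  qed
qed

lemma link_step_unwelded:
  assumes "link_step n D E"
  shows "unwelded_equivalent D E"
proof -
  have wf: "wf_gauss D" "wf_gauss E"
    using assms by (auto simp: link_step_def virtual_string_link_def)
  consider "unwelded_step D E" | p q where "adjacent D p q" "E = exchange p q D"
    using assms wf unfolding link_step_def unwelded_step_def reidemeister_def by blast
  then show ?thesis
    using unwelded_exchange[OF wf(1)] by cases (auto simp: unwelded_equivalent_def)
qed

lemma link_steps_unwelded:
  assumes "(link_step n)\<^sup>*\<^sup>* D E"
  shows "unwelded_equivalent D E"
  using assms
proof (induction rule: rtranclp_induct)
  case (step E F)
  then show ?case
    using link_step_unwelded[OF step(2)] by (simp add: unwelded_equivalent_def)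
qed (simp add: unwelded_equivalent_def)

section \<open>Cobordisms assembled step by step\<close>

text \<open>
  A cobordism without births from \<open>L\<close>, built step by step. The label of a component is the strand
  of \<open>L\<close> to which the surface joins it.
\<close>

inductive traced :: "nat \<Rightarrow> gauss_diagram \<Rightarrow> gauss_diagram \<Rightarrow> (component \<Rightarrow> nat) \<Rightarrow> bool"
  for n L where
  start: "virtual_string_link n L \<Longrightarrow> traced n L L strand_label"
| step: "traced n L D s \<Longrightarrow> cob_step D R E \<Longrightarrow> wf_gauss E \<Longrightarrow>
    (\<And>c c'. (c, c') \<in> R \<Longrightarrow> s' c' = s c) \<Longrightarrow>
    (\<And>c'. c' \<in> components E \<Longrightarrow> \<exists>c\<in>components D. (c, c') \<in> R) \<Longrightarrow> traced n L E s'"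

text \<open>Constancy of \<open>S\<close> along \<open>R\<close> keeps the surfaces over different
  strands apart. The paths from level 0 show that there are no further surface components.\<close>

definition labelled_movie ::
    "nat \<Rightarrow> nat \<Rightarrow> (nat \<Rightarrow> gauss_diagram) \<Rightarrow> (nat \<Rightarrow> (component \<times> component) set)
      \<Rightarrow> (nat \<Rightarrow> component \<Rightarrow> nat) \<Rightarrow> bool" where
  "labelled_movie n m D R S \<longleftrightarrow> movie m D R \<and>
    (\<forall>t\<le>m. strands (D t) = n) \<and>
    (\<forall>t<m. \<forall>c c'. (c, c') \<in> R t \<longrightarrow> S (Suc t) c' = S t c) \<and>
    (\<forall>t\<le>m. \<forall>i\<in>{1..n}. S t (Strand i) = i) \<and>
    (\<forall>t\<le>m. \<forall>c\<in>components (D t). S t c \<in> {1..n} \<and> ((0, Strand (S t c)), (t, c)) \<in> (joined m R)\<^sup>*)"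

text \<open>Turns the inductive construction into the indexed families required by
  \<open>cobordant\<close>. Each step overwrites the value just beyond the current last level,
  leaving all earlier levels and their paths intact.\<close>

lemma traced_movie:
  assumes "traced n L E s"
  shows "\<exists>m D R S. D 0 = L \<and> D m = E \<and> S m = s \<and> labelled_movie n m D R S"
  using assms
proof (induction rule: traced.induct)
  case start
  then show ?case
    by (intro exI[of _ 0] exI[of _ "\<lambda>_. L"] exI[of _ "\<lambda>_. {}"] exI[of _ "\<lambda>_. strand_label"])
       (auto simp: labelled_movie_def virtual_string_link_def movie_def strand_label_def components_def)
next
  case (step E s R0 F s')
  then obtain m D R S where ends: "D 0 = L" "D m = E" "S m = s"
    and lm: "labelled_movie n m D R S" by blast
  from lm have mov: "movie m D R"
    and n: "\<And>t. t \<le> m \<Longrightarrow> strands (D t) = n"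
    and lab: "\<And>t c c'. t < m \<Longrightarrow> (c, c') \<in> R t \<Longrightarrow> S (Suc t) c' = S t c"
    and Str: "\<And>t i. t \<le> m \<Longrightarrow> i \<in> {1..n} \<Longrightarrow> S t (Strand i) = i"
    and conn: "\<And>t c. t \<le> m \<Longrightarrow> c \<in> components (D t) \<Longrightarrow>
        S t c \<in> {1..n} \<and> ((0, Strand (S t c)), (t, c)) \<in> (joined m R)\<^sup>*"
    unfolding labelled_movie_def by simp_all
  define D' where "D' = D(Suc m := F)"
  define R' where "R' = R(m := R0)"
  define S' where "S' = S(Suc m := s')"
  have old: "D' t = D t" "S' t = S t" if "t \<le> m" for t
    using that by (auto simp: D'_def S'_def)
  have oldR: "R' t = R t" if "t < m" for t using that by (auto simp: R'_def)
  have new: "D' (Suc m) = F" "S' (Suc m) = s'" "R' m = R0" by (simp_all add: D'_def S'_def R'_def)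
  have J: "(joined m R)\<^sup>* \<subseteq> (joined (Suc m) R')\<^sup>*"
    by (rule rtrancl_mono) (auto simp: joined_def oldR less_SucI)
  have Jnew: "((m, c), (Suc m, c')) \<in> joined (Suc m) R'" if "(c, c') \<in> R0" for c c'
    using that new by (auto simp: joined_def)
  have "movie (Suc m) D' R'"
    using mov step.hyps(2,3) ends old oldR new
    by (auto simp: movie_def le_Suc_eq less_Suc_eq)
  moreover have "\<forall>t\<le>Suc m. strands (D' t) = n"
    using n[of m] n cob_step_strands[OF step.hyps(2)] ends old new by (auto simp: le_Suc_eq)
  moreover have "\<forall>t<Suc m. \<forall>c c'. (c, c') \<in> R' t \<longrightarrow> S' (Suc t) c' = S' t c"
    using lab step.hyps(4) ends old oldR new by (auto simp: less_Suc_eq)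
  moreover have "\<forall>t\<le>Suc m. \<forall>i\<in>{1..n}. S' t (Strand i) = i"
  proof -
    have "s' (Strand i) = i" if "i \<in> {1..n}" for i
    proof -
      have "(Strand i, Strand i) \<in> R0"
        using cob_step_Strand[OF step.hyps(2)] that n[of m] ends by simp
      from step.hyps(4)[OF this] show ?thesis using Str[of m i] that ends by simp
    qed
    then show ?thesis using Str old new by (auto simp: le_Suc_eq)
  qed
  moreover have "\<forall>t\<le>Suc m. \<forall>c\<in>components (D' t). S' t c \<in> {1..n} \<and>
      ((0, Strand (S' t c)), (t, c)) \<in> (joined (Suc m) R')\<^sup>*"
  proof (intro allI impI ballI)
    fix t c assume t: "t \<le> Suc m" and c: "c \<in> components (D' t)"
    show "S' t c \<in> {1..n} \<and> ((0, Strand (S' t c)), (t, c)) \<in> (joined (Suc m) R')\<^sup>*"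
    proof (cases "t = Suc m")
      case False
      then show ?thesis using conn[of t c] J old t c by auto
    next
      case True
      with c new obtain b where b: "b \<in> components E" "(b, c) \<in> R0"
        using step.hyps(5) by auto
      then have "s' c = S m b" using step.hyps(4) ends by simp
      then show ?thesis
        using conn[of m b] b ends J Jnew[OF b(2)] True new
        by (auto intro: rtrancl_into_rtrancl)
    qed
  qed
  moreover have "D' 0 = L" using ends old by simp
  ultimately have "labelled_movie n (Suc m) D' R' S'"
    unfolding labelled_movie_def by blast
  with \<open>D' 0 = L\<close> new show ?case by blast
qed

text \<open>The label is a complete invariant of the surface components: it is constant on each of
  them, and everything labelled \<open>k\<close> is joined to strand \<open>k\<close> at level
  0.\<close>

lemma traced_cobordant:
  assumes "traced n L E s" "virtual_string_link n E"
  shows "cobordant n L E"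
proof -
  obtain m D R S where ends: "D 0 = L" "D m = E" and lm: "labelled_movie n m D R S"
    using traced_movie[OF assms(1)] by blast
  from lm have mov: "movie m D R"
    and n: "\<And>t. t \<le> m \<Longrightarrow> strands (D t) = n"
    and lab: "\<And>t c c'. t < m \<Longrightarrow> (c, c') \<in> R t \<Longrightarrow> S (Suc t) c' = S t c"
    and Str: "\<And>t i. t \<le> m \<Longrightarrow> i \<in> {1..n} \<Longrightarrow> S t (Strand i) = i"
    and conn: "\<And>t c. t \<le> m \<Longrightarrow> c \<in> components (D t) \<Longrightarrow>
        S t c \<in> {1..n} \<and> ((0, Strand (S t c)), (t, c)) \<in> (joined m R)\<^sup>*"
    unfolding labelled_movie_def by simp_all
  define J where "J = (joined m R \<union> (joined m R)\<inverse>)\<^sup>*"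
  define cls where "cls i = J `` {(0, Strand i)}" for i
  have "equiv UNIV J"
    unfolding J_def equiv_def by (auto simp: refl_rtrancl trans_rtrancl intro: sym_rtrancl symI)
  note class_eq = equiv_class_eq[OF this]
  have inv: "S t' c' = S t c" if "((t, c), (t', c')) \<in> J" for t c t' c'
    using that unfolding J_def
  proof (induction "(t', c')" arbitrary: t' c' rule: rtrancl_induct)
    case (step y)
    then show ?case using lab by (cases y) (fastforce simp: joined_def)
  qed simp
  have J: "(joined m R)\<^sup>* \<subseteq> J"
    unfolding J_def by (rule rtrancl_mono) blast
  have mem0: "(0, Strand i) \<in> cls k \<longleftrightarrow> i = k" if "i \<in> {1..n}" "k \<in> {1..n}" for i k
    using inv[of 0 "Strand k" 0 "Strand i"] Str[of 0] that by (auto simp: cls_def J_def)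
  have memm: "(m, Strand i) \<in> cls k \<longleftrightarrow> i = k" if "i \<in> {1..n}" "k \<in> {1..n}" for i k
  proof
    assume "(m, Strand i) \<in> cls k"
    then show "i = k" using inv[of 0 "Strand k" m "Strand i"] Str[of 0] Str[of m] that
      by (simp add: cls_def)
  next
    assume "i = k"
    then show "(m, Strand i) \<in> cls k"
      using conn[of m "Strand k"] J Str[of m k] n[of m] that by (auto simp: cls_def)
  qed
  have surf: "surface_components m D R = cls ` {1..n}"
  proof -
    have cls: "J `` {(t, c)} = cls (S t c)" "S t c \<in> {1..n}" if "t \<le> m" "c \<in> components (D t)" for t c
      unfolding cls_def using conn[OF that] J by (auto intro!: class_eq[symmetric])
    show ?thesis
    proof (intro equalityI subsetI)
      fix K assume "K \<in> surface_components m D R"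
      then obtain t c where "t \<le> m" "c \<in> components (D t)" "K = J `` {(t, c)}"
        unfolding surface_components_def J_def[symmetric] levels_def by (auto elim!: quotientE)
      then show "K \<in> cls ` {1..n}" using cls by blast
    next
      fix K assume "K \<in> cls ` {1..n}"
      then obtain i where i: "i \<in> {1..n}" "K = J `` {(0, Strand i)}" unfolding cls_def by blast
      then have "(0, Strand i) \<in> levels m D" using n[of 0] by (simp add: levels_def)
      then show "K \<in> surface_components m D R"
        unfolding surface_components_def J_def[symmetric] i(2) by (rule quotientI)
    qed
  qed
  have "inj_on cls {1..n}"
    using mem0 by (intro inj_onI) blast
  then have "card (surface_components m D R) = n"
    unfolding surf by (simp add: card_image)
  moreover have "(\<exists>!i. i \<in> {1..n} \<and> (0, Strand i) \<in> K) \<and> (\<exists>!i. i \<in> {1..n} \<and> (m, Strand i) \<in> K)"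
    if K: "K \<in> surface_components m D R" for K
  proof -
    obtain k where k: "k \<in> {1..n}" "K = cls k" using K unfolding surf by blast
    show ?thesis
      unfolding k(2) by (intro conjI ex1I[of _ k]; use mem0[OF _ k(1)] memm[OF _ k(1)] k(1) in blast)
  qed
  ultimately show ?thesis
    unfolding cobordant_def using ends mov
    by (intro exI[of _ m] exI[of _ D] exI[of _ R] conjI ballI) simp_all
qed

section \<open>Exchanging endpoints by two saddles\<close>

lemma wf_saddle_split:
  assumes wf: "wf_gauss D" and "saddle_split c k D E"
  shows "wf_gauss E"
proof -
  obtain u v w where c: "c \<in> components D" and k: "k \<notin> circs D" and w: "word D c = u @ v @ w"
    and E: "E = D\<lparr>circs := insert k (circs D), word := (word D)(c := u @ w, Circle k := v)\<rparr>"
    using assms(2) unfolding saddle_split_def by blast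
  have comp: "components E = insert (Circle k) (components D)"
    by (auto simp: E components_def)
  have ne: "d \<noteq> Circle k" if "d \<in> components D" for d using that k by auto
  have wE: "word E d = (if d = c then u @ w else word D d)" if "d \<in> components D" for d
    using ne[OF that] by (simp add: E)
  have wk: "word E (Circle k) = v" by (simp add: E)
  have ends: "endpoints E = endpoints D"
  proof -
    have "endpoints E = set v \<union> (\<Union>d\<in>components D. set (word E d))"
      unfolding endpoints_def comp by (simp add: wk)
    also have "\<dots> = set v \<union> (set (u @ w) \<union> (\<Union>d\<in>components D - {c}. set (word D d)))"
      using c wE by (auto split: if_splits)
    also have "\<dots> = endpoints D"
      unfolding endpoints_def using c w by (subst insert_Diff[OF c, symmetric]) (simp only: UN_insert set_append Un_ac)
    finally show ?thesis .
  qed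
  have "distinct (u @ v @ w)" using wf_gauss_distinct[OF wf c] w by simp
  then have 1: "distinct (word E d)" if "d \<in> components E" for d
    using that wf_gauss_distinct[OF wf] wE wk unfolding comp by auto
  have sub: "set (word E d) \<subseteq> set (word D d)" if "d \<in> components D" for d
    using that wE w by auto
  have v: "set v \<inter> set (word E d) = {}" if d: "d \<in> components D" for d
  proof (cases "d = c")
    case True
    then show ?thesis using wE[OF d] \<open>distinct (u @ v @ w)\<close> by auto
  next
    case False
    then have "set (word D c) \<inter> set (word D d) = {}"
      using wf_gauss_unique_component[OF wf c d] by blast
    then show ?thesis using sub[OF d] w by auto
  qed
  have 2: "set (word E d) \<inter> set (word E d') = {}"
    if d: "d \<in> components E" "d' \<in> components E" "d \<noteq> d'" for d d'
  proof -
    consider "d = Circle k" "d' \<in> components D" | "d' = Circle k" "d \<in> components D"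
      | "d \<in> components D" "d' \<in> components D"
      using d comp by auto
    then show ?thesis
    proof cases
      case 1
      then show ?thesis using v[of d'] wk by simp
    next
      case 2
      then show ?thesis using v[of d] wk by (simp add: Int_commute)
    next
      case 3
      then have "set (word D d) \<inter> set (word D d') = {}"
        using wf_gauss_unique_component[OF wf 3] d(3) by blast
      then show ?thesis using sub[of d] sub[of d'] 3 by blast
    qed
  qed
  have ar: "arrows E = arrows D" by (simp add: arrows_def ends)
  have wr: "writhe E = writhe D" by (simp add: E)
  have "finite (circs E)" using wf by (simp add: E wf_gauss_def)
  moreover have "\<forall>a\<in>arrows D. Tail a \<in> endpoints D \<and> Head a \<in> endpoints D \<and> writhe D a \<in> {1, -1}"
    using wf unfolding wf_gauss_def by blast
  ultimately show ?thesis
    using 1 2 unfolding wf_gauss_def ends ar wr by blast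
qed

lemma word_exchange_consec:
  assumes wf: "wf_gauss D" and c: "c \<in> components D" and w: "word D c = u @ p # q # v"
    and d: "d \<in> components D"
  shows "word (exchange p q D) d = (if d = c then u @ q # p # v else word D d)"
proof -
  have fixed: "map (id(p := q, q := p)) xs = xs" if "p \<notin> set xs" "q \<notin> set xs" for xs
    using that by (induction xs) auto
  show ?thesis
  proof (cases "d = c")
    case True
    have "distinct (u @ p # q # v)" using wf_gauss_distinct[OF wf c] w by simp
    then show ?thesis
      using True fixed[of u] fixed[of v] unfolding word_exchange by (auto simp: w)
  next
    case False
    then have "set (word D c) \<inter> set (word D d) = {}"
      using wf_gauss_unique_component[OF wf c d] by blast
    then have "word (exchange p q D) d = word D d"
      unfolding word_exchange by (intro fixed) (auto simp: w)
    with False show ?thesis by simp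
  qed
qed

text \<open>
  To exchange two adjacent endpoints, split off a circle containing exactly these two, rotate it
  by half a turn and merge it back.
\<close>

lemma traced_exchange:
  assumes tr: "traced n L D s" and D: "virtual_string_link n D" and con: "consec D p q"
  shows "\<exists>s'. traced n L (exchange p q D) s'"
proof -
  have wf: "wf_gauss D" and nc: "circs D = {}" and n: "strands D = n"
    using D by (auto simp: virtual_string_link_def)
  obtain c u v where c: "c \<in> components D" and w: "word D c = u @ p # q # v"
    using con nc unfolding consec_def by blast
  have c0: "c \<noteq> Circle k" for k using c nc by auto
  \<comment> \<open>A string link has no circles, so the name 0 is free.\<close>
  define D1 where "D1 = D\<lparr>circs := {0}, word := (word D)(c := u @ v, Circle 0 := [p, q])\<rparr>"
  define D2 where "D2 = D\<lparr>circs := {0}, word := (word D)(c := u @ v, Circle 0 := [q, p])\<rparr>"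
  define D3 where "D3 = D\<lparr>word := (word D)(c := u @ q # p # v)\<rparr>"
  have comp: "components D1 = insert (Circle 0) (components D)"
      "components D2 = insert (Circle 0) (components D)" "components D3 = components D"
    using nc by (auto simp: D1_def D2_def D3_def components_def)
  have split: "saddle_split c 0 D D1"
    unfolding saddle_split_def D1_def
    using c nc w by (intro conjI exI[of _ u] exI[of _ "[p, q]"] exI[of _ v]) simp_all
  have merge: "saddle_split c 0 D3 D2"
    unfolding saddle_split_def comp
    using c nc by (intro conjI exI[of _ u] exI[of _ "[q, p]"] exI[of _ v]) (simp_all add: D2_def D3_def)
  have wf1: "wf_gauss D1" by (rule wf_saddle_split[OF wf split])
  have dist: "distinct (u @ p # q # v)" using wf_gauss_distinct[OF wf c] w by simp
  have wf3: "wf_gauss D3"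
    by (rule wf_gauss_cong[OF wf])
       (use dist w wf_gauss_distinct[OF wf] in \<open>auto simp: D3_def\<close>)
  have wf2: "wf_gauss D2" by (rule wf_saddle_split[OF wf3 merge])
  \<comment> \<open>The circle inherits the label of the component it leaves. It later merges into
    that same component, so no two pieces of surface over different strands become joined.\<close>
  define s' where "s' = s(Circle 0 := s c)"
  have s': "s' d = s d" if "d \<in> components D" for d
    using that nc by (auto simp: s'_def)
  have t1: "traced n L D1 s'"
  proof (rule traced.step[OF tr cob_split[OF split] wf1])
    show "s' d' = s d" if "(d, d') \<in> insert (c, Circle 0) (Id_on (components D))" for d d'
      using that s' by (auto simp: s'_def nc)
    show "\<exists>d\<in>components D. (d, d') \<in> insert (c, Circle 0) (Id_on (components D))"
      if "d' \<in> components D1" for d'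
      using that c unfolding comp by blast
  qed
  \<comment> \<open>Moving the base point of a circle with two endpoints past one of them
    interchanges the two letters of its word.\<close>
  have "isotopy id D1 D2"
    unfolding isotopy_def
  proof (intro conjI exI[of _ id] ballI)
    fix k assume "k \<in> circs D1"
    then show "\<exists>r. word D2 (Circle (id k)) = rotate r (map (map_endpoint id) (word D1 (Circle k)))"
      by (intro exI[of _ 1]) (simp add: D1_def D2_def endpoint.map_id0)
  qed (use c0 in \<open>auto simp: D1_def D2_def endpoint.map_id0\<close>)
  then have t2: "traced n L D2 s'"
  proof (rule traced.step[OF t1 cob_isotopy wf2])
    fix d' assume "d' \<in> components D2"
    then show "\<exists>d\<in>components D1. (d, d') \<in> {(Strand i, Strand i) |i. i \<in> {1..strands D1}} \<union>
        {(Circle k, Circle (id k)) |k. k \<in> circs D1}"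
      unfolding comp(2) comp(1)[symmetric] by (auto simp: components_def)
  qed auto
  have t3: "traced n L D3 s'"
  proof (rule traced.step[OF t2 cob_merge[OF merge] wf3])
    show "s' d' = s' d" if "(d, d') \<in> insert (Circle 0, c) (Id_on (components D3))" for d d'
      using that s'[OF c] by (auto simp: s'_def)
    show "\<exists>d\<in>components D2. (d, d') \<in> insert (Circle 0, c) (Id_on (components D3))"
      if "d' \<in> components D3" for d'
      using that unfolding comp by blast
  qed
  have "isotopy id D3 (exchange p q D)"
  proof (rule isotopy_id)
    fix d assume d: "d \<in> components D3"
    show "word (exchange p q D) d = word D3 d"
      using word_exchange_consec[OF wf c w] d comp(3) by (simp add: D3_def)
  qed (simp_all add: D3_def)
  then have "traced n L (exchange p q D) s'"
  proof (rule traced.step[OF t3 cob_isotopy])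
    show "wf_gauss (exchange p q D)" by (rule wf_exchange[OF wf consec_same_component[OF con]])
    fix d' assume "d' \<in> components (exchange p q D)"
    then show "\<exists>d\<in>components D3. (d, d') \<in> {(Strand i, Strand i) |i. i \<in> {1..strands D3}} \<union>
        {(Circle k, Circle (id k)) |k. k \<in> circs D3}"
      unfolding exchange_simps comp(3)[symmetric] by (auto simp: components_def)
  qed auto
  then show ?thesis by blast
qed

lemma traced_link_step:
  assumes tr: "traced n L D s" and "link_step n D E"
  shows "\<exists>s'. traced n L E s'"
proof -
  have D: "virtual_string_link n D" and E: "virtual_string_link n E"
    using assms(2) by (auto simp: link_step_def)
  have comp: "components D = Strand ` {1..n}" "components E = Strand ` {1..n}"
    using D E by (auto simp: virtual_string_link_def components_def)
  have wfE: "wf_gauss E" using E by (simp add: virtual_string_link_def)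
  consider \<pi> where "isotopy \<pi> D E" | p q where "adjacent D p q" "E = exchange p q D"
    | "reidemeister D E"
    using assms(2) unfolding link_step_def reidemeister_def by blast
  then show ?thesis
  proof cases
    case 1
    show ?thesis
      by (rule exI, rule traced.step[OF tr cob_isotopy[OF 1] wfE, of s])
         (use D in \<open>auto simp: comp virtual_string_link_def\<close>)
  next
    case 2
    then show ?thesis
      using traced_exchange[OF tr D] exchange_sym unfolding adjacent_def by metis
  next
    case 3
    show ?thesis
      by (rule exI, rule traced.step[OF tr cob_reidemeister[OF 3] wfE, of s]) (auto simp: comp)
  qed
qed

lemma link_steps_cobordant:
  assumes "(link_step n)\<^sup>*\<^sup>* L L'" "virtual_string_link n L"
  shows "cobordant n L L'"
proof -
  have "virtual_string_link n L' \<and> (\<exists>s. traced n L L' s)"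
    using assms(1)
  proof (induction rule: rtranclp_induct)
    case base
    then show ?case using assms(2) traced.start by blast
  next
    case (step D E)
    have "virtual_string_link n E" using step.hyps(2) by (simp add: link_step_def)
    with step show ?case using traced_link_step by blast
  qed
  then show ?thesis using traced_cobordant by blast
qed

section \<open>Classification by linking numbers\<close>

lemma link_stepI:
  assumes "virtual_string_link n D" "virtual_string_link n E"
    and "(\<exists>\<pi>. isotopy \<pi> D E) \<or> (\<exists>p q. adjacent D p q \<and> E = exchange p q D) \<or>
      rm1_delete D E \<or> rm2_delete D E"
  shows "link_step n D E"
  using assms unfolding link_step_def by blast

lemma components_string_link:
  "virtual_string_link n D \<Longrightarrow> components D = Strand ` {1..n}"
  by (auto simp: virtual_string_link_def components_def)

lemma endpoints_string_link:
  "virtual_string_link n D \<Longrightarrow> endpoints D = (\<Union>i\<in>{1..n}. set (word D (Strand i)))"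
  by (simp add: endpoints_def components_string_link)

lemma arrow_of_in_arrows:
  assumes "virtual_string_link n D" "i \<in> {1..n}" "p \<in> set (word D (Strand i))"
  shows "arrow_of p \<in> arrows D"
  unfolding arrows_def endpoints_string_link[OF assms(1)] using assms(2,3) by blast

text \<open>Without circles there are no base points to shift back: only the renaming of arrows has
  to be inverted, and any map, here \<open>id\<close>, serves on the empty set of circles.\<close>

lemma isotopy_sym:
  assumes D: "virtual_string_link n D" and E: "virtual_string_link n E" and iso: "isotopy \<pi> D E"
  shows "isotopy id E D"
proof -
  obtain f where inj: "inj_on f (arrows D)"
    and wr: "\<And>a. a \<in> arrows D \<Longrightarrow> writhe E (f a) = writhe D a"
    and word: "\<And>i. i \<in> {1..n} \<Longrightarrow> word E (Strand i) = map (map_endpoint f) (word D (Strand i))"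
    using iso D unfolding isotopy_def virtual_string_link_def by blast
  define g where "g = inv_into (arrows D) f"
  have g: "g (f a) = a" if "a \<in> arrows D" for a using that inj by (simp add: g_def)
  have "endpoints E = map_endpoint f ` endpoints D"
    unfolding endpoints_string_link[OF D] endpoints_string_link[OF E]
    by (simp add: word image_UN)
  moreover have "arrow_of (map_endpoint f p) = f (arrow_of p)" for p by (cases p) simp_all
  ultimately have ar: "arrows E = f ` arrows D"
    by (simp add: arrows_def image_image)
  have "map (map_endpoint g) (word E (Strand i)) = word D (Strand i)" if i: "i \<in> {1..n}" for i
  proof -
    have "map_endpoint g (map_endpoint f p) = p" if "p \<in> set (word D (Strand i))" for p
    proof -
      have "arrow_of p \<in> arrows D"
        by (rule arrow_of_in_arrows[OF D i that])
      then show ?thesis using g by (cases p) auto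
    qed
    then show ?thesis by (simp add: word[OF i] map_idI)
  qed
  moreover have "inj_on g (arrows E)"
    unfolding ar by (rule inj_on_inverseI[of _ f]) (use g in auto)
  moreover have "writhe D (g b) = writhe E b" if "b \<in> arrows E" for b
    using that wr g unfolding ar by auto
  ultimately show ?thesis
    using D E unfolding isotopy_def virtual_string_link_def
    by (intro conjI exI[of _ g]) auto
qed

lemma link_step_sym: "link_step n D E \<Longrightarrow> link_step n E D"
  unfolding link_step_def using isotopy_sym adjacent_exchanged exchange_exchange by metis

lemma link_steps_sym: "(link_step n)\<^sup>*\<^sup>* D E \<Longrightarrow> (link_step n)\<^sup>*\<^sup>* E D"
  by (induction rule: rtranclp_induct) (auto intro: link_step_sym converse_rtranclp_into_rtranclp)

lemma link_steps_string_link: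
  "(link_step n)\<^sup>*\<^sup>* D E \<Longrightarrow> virtual_string_link n D \<Longrightarrow> virtual_string_link n E"
  by (induction rule: rtranclp_induct) (auto simp: link_step_def)

section \<open>Permuting the endpoints along each strand\<close>

lemma string_link_perm:
  assumes D: "virtual_string_link n D" and E: "strands E = n" "circs E = {}"
    and words: "\<And>i. i \<in> {1..n} \<Longrightarrow> mset (word E (Strand i)) = mset (word D (Strand i))"
    and wr: "\<And>a. a \<in> arrows D \<Longrightarrow> writhe E a = writhe D a"
  shows "virtual_string_link n E"
proof -
  have wf: "wf_gauss D" using D by (simp add: virtual_string_link_def)
  have "wf_gauss E"
  proof (rule wf_gauss_cong[OF wf])
    fix c assume c: "c \<in> components D"
    then have "mset (word E c) = mset (word D c)"
      using words by (auto simp: components_string_link[OF D])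
    then show "distinct (word E c) \<and> set (word E c) = set (word D c)"
      using wf_gauss_distinct[OF wf c] mset_eq_imp_distinct_iff mset_eq_setD by metis
  qed (use D E wr in \<open>auto simp: virtual_string_link_def\<close>)
  then show ?thesis using E by (simp add: virtual_string_link_def)
qed

definition adjacent_swap :: "'a list \<Rightarrow> 'a list \<Rightarrow> bool" where
  "adjacent_swap xs ys \<longleftrightarrow> (\<exists>u p q v. xs = u @ p # q # v \<and> ys = u @ q # p # v)"

lemma adjacent_swaps_Cons:
  assumes "adjacent_swap\<^sup>*\<^sup>* xs ys"
  shows "adjacent_swap\<^sup>*\<^sup>* (x # xs) (x # ys)"
  using assms
proof (induction rule: rtranclp_induct)
  case (step ys zs)
  have "adjacent_swap (x # ys) (x # zs)"
    using step.hyps(2) unfolding adjacent_swap_def by (metis append_Cons)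
  with step.IH show ?case by (rule rtranclp.rtrancl_into_rtrancl)
qed simp

lemma adjacent_swaps_move: "adjacent_swap\<^sup>*\<^sup>* (x # u @ v) (u @ x # v)"
proof (induction u)
  case (Cons y u)
  have "adjacent_swap (x # (y # u) @ v) (y # x # u @ v)"
    unfolding adjacent_swap_def by (intro exI[of _ "[]"]) auto
  moreover have "adjacent_swap\<^sup>*\<^sup>* (y # x # u @ v) (y # u @ x # v)"
    using Cons.IH by (rule adjacent_swaps_Cons)
  ultimately show ?case by (simp add: converse_rtranclp_into_rtranclp)
qed simp

text \<open>Insertion sort: the rest of the list is first put into its target order, then the first
  entry is carried to its place.\<close>

lemma adjacent_swaps_perm: "mset xs = mset ys \<Longrightarrow> adjacent_swap\<^sup>*\<^sup>* xs ys"
proof (induction xs arbitrary: ys)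
  case (Cons x xs)
  then have "x \<in> set ys" by (metis list.set_intros(1) mset_eq_setD)
  then obtain u v where ys: "ys = u @ x # v" by (meson split_list)
  then have "mset xs = mset (u @ v)" using Cons.prems by simp
  then have "adjacent_swap\<^sup>*\<^sup>* (x # xs) (x # u @ v)"
    by (intro adjacent_swaps_Cons Cons.IH)
  then show ?case using adjacent_swaps_move ys by (metis rtranclp_trans)
qed simp

lemma adjacent_swap_mset: "adjacent_swap xs ys \<Longrightarrow> mset xs = mset ys"
  by (auto simp: adjacent_swap_def)

lemma link_steps_perm_strand:
  assumes D: "virtual_string_link n D" and i: "i \<in> {1..n}"
    and "mset (word D (Strand i)) = mset ys"
  shows "(link_step n)\<^sup>*\<^sup>* D (D\<lparr>word := (word D)(Strand i := ys)\<rparr>)"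
proof -
  let ?D = "\<lambda>ys. D\<lparr>word := (word D)(Strand i := ys)\<rparr>"
  have "mset (word D (Strand i)) = mset ys \<and> (link_step n)\<^sup>*\<^sup>* D (?D ys)"
    using adjacent_swaps_perm[OF assms(3)]
  proof (induction rule: rtranclp_induct)
    case (step ys zs)
    obtain u p q v where ys: "ys = u @ p # q # v" and zs: "zs = u @ q # p # v"
      using step.hyps(2) unfolding adjacent_swap_def by blast
    have m: "mset (word D (Strand i)) = mset ys" "mset (word D (Strand i)) = mset zs"
      using step.IH adjacent_swap_mset[OF step.hyps(2)] by simp_all
    have sl: "virtual_string_link n (?D ys)" "virtual_string_link n (?D zs)"
      by (rule string_link_perm[OF D]; use D m in \<open>auto simp: virtual_string_link_def\<close>)+
    then have wf: "wf_gauss (?D ys)" by (simp add: virtual_string_link_def)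
    have c: "Strand i \<in> components (?D ys)" and w: "word (?D ys) (Strand i) = u @ p # q # v"
      using i D by (simp_all add: virtual_string_link_def ys)
    have con: "consec (?D ys) p q" unfolding consec_def using c w by blast
    let ?E = "exchange p q (?D ys)"
    have slE: "virtual_string_link n ?E"
      using wf_exchange[OF wf consec_same_component[OF con]] D by (simp add: virtual_string_link_def)
    have "link_step n (?D ys) ?E"
      using sl(1) slE con by (intro link_stepI) (auto simp: adjacent_def)
    moreover have "isotopy id ?E (?D zs)"
    proof (rule isotopy_id)
      fix d assume "d \<in> components ?E"
      then have d: "d \<in> components (?D ys)" by simp
      show "word (?D zs) d = word ?E d"
        using word_exchange_consec[OF wf c w d] by (simp add: zs)
    qed simp_all
    then have "link_step n ?E (?D zs)" using slE sl(2) by (intro link_stepI) auto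
    ultimately show ?case using step.IH m by (meson rtranclp.rtrancl_into_rtrancl)
  qed simp
  then show ?thesis by blast
qed

lemma link_steps_perm:
  assumes D: "virtual_string_link n D" and E: "strands E = n" "circs E = {}"
    and words: "\<And>i. i \<in> {1..n} \<Longrightarrow> mset (word E (Strand i)) = mset (word D (Strand i))"
    and wr: "\<And>a. a \<in> arrows D \<Longrightarrow> writhe E a = writhe D a"
  shows "(link_step n)\<^sup>*\<^sup>* D E"
proof -
  let ?D = "\<lambda>k. D\<lparr>word := \<lambda>c. if c \<in> Strand ` {1..k} then word E c else word D c\<rparr>"
  have "(link_step n)\<^sup>*\<^sup>* D (?D k)" if "k \<le> n" for k
    using that
  proof (induction k)
    case (Suc k)
    let ?w = "word E (Strand (Suc k))"
    have IH: "(link_step n)\<^sup>*\<^sup>* D (?D k)" using Suc by simp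
    have "(link_step n)\<^sup>*\<^sup>* (?D k) ((?D k)\<lparr>word := (word (?D k))(Strand (Suc k) := ?w)\<rparr>)"
      by (rule link_steps_perm_strand[OF link_steps_string_link[OF IH D]])
         (use Suc.prems words[of "Suc k"] in auto)
    moreover have "(word (?D k))(Strand (Suc k) := ?w) = word (?D (Suc k))"
      by (auto simp: fun_eq_iff atLeastAtMostSuc_conv)
    ultimately show ?case using IH by (simp add: rtranclp_trans)
  qed simp
  then have steps: "(link_step n)\<^sup>*\<^sup>* D (?D n)" by simp
  have slE: "virtual_string_link n E" by (rule string_link_perm[OF assms])
  have slD: "virtual_string_link n (?D n)" by (rule link_steps_string_link[OF steps D])
  have "endpoints (?D n) = endpoints D"
    unfolding endpoints_string_link[OF slD] endpoints_string_link[OF D]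
    using words by (intro SUP_cong) (auto dest: mset_eq_setD)
  then have ar: "arrows (?D n) = arrows D" by (simp add: arrows_def)
  have "isotopy id (?D n) E"
  proof (rule isotopy_id)
    show "word E c = word (?D n) c" if "c \<in> components (?D n)" for c
      using that unfolding components_string_link[OF slD] by simp
    show "writhe E a = writhe (?D n) a" if "a \<in> arrows (?D n)" for a
      using that wr unfolding ar by simp
  qed (use D E in \<open>auto simp: virtual_string_link_def\<close>)
  then have "link_step n (?D n) E" using slD slE by (intro link_stepI) auto
  with steps show ?thesis by (rule rtranclp.rtrancl_into_rtrancl)
qed

section \<open>Cancelling arrows\<close>

text \<open>Collecting the ends of the chosen arrows at the start of each strand makes them
  adjacent, as RM1 and RM2 require. The order of all other endpoints is kept, so deleting
  \<open>A\<close> now or before gathering gives the same diagram.\<close>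

definition gather :: "nat set \<Rightarrow> gauss_diagram \<Rightarrow> gauss_diagram" where
  "gather A D = D\<lparr>word := \<lambda>c. filter (\<lambda>p. arrow_of p \<in> A) (word D c) @
     filter (\<lambda>p. arrow_of p \<notin> A) (word D c)\<rparr>"

lemma link_steps_gather:
  assumes "virtual_string_link n D"
  shows "(link_step n)\<^sup>*\<^sup>* D (gather A D)"
  by (rule link_steps_perm[OF assms])
     (use assms in \<open>auto simp: gather_def virtual_string_link_def\<close>)

lemma delete_gather: "delete_arrows A (gather A D) = delete_arrows A D"
  by (simp add: delete_arrows_def gather_def)

lemma distinct_set_two:
  assumes "distinct xs" "set xs = {p, q}" "p \<noteq> q"
  shows "xs = [p, q] \<or> xs = [q, p]"
proof -
  have "length xs = 2" using distinct_card[OF assms(1)] assms(2,3) by simp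
  then obtain a b where "xs = [a, b]" by (auto simp: length_Suc_conv numeral_2_eq_2)
  then show ?thesis using assms by (auto simp: doubleton_eq_iff)
qed

lemma adjacent_gather:
  assumes D: "virtual_string_link n D" and i: "i \<in> {1..n}"
    and two: "{r \<in> set (word D (Strand i)). arrow_of r \<in> A} = {p, q}" "p \<noteq> q"
  shows "adjacent (gather A D) p q"
proof -
  let ?w = "filter (\<lambda>p. arrow_of p \<in> A) (word D (Strand i))"
  have c: "Strand i \<in> components (gather A D)" "Strand i \<in> components D"
    using D i by (simp_all add: gather_def virtual_string_link_def)
  then have "distinct (word D (Strand i))"
    using D wf_gauss_distinct by (auto simp: virtual_string_link_def)
  then have "?w = [p, q] \<or> ?w = [q, p]"
    using two by (intro distinct_set_two) auto
  then have "word (gather A D) (Strand i) = [] @ p # q # filter (\<lambda>p. arrow_of p \<notin> A) (word D (Strand i)) \<or>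
      word (gather A D) (Strand i) = [] @ q # p # filter (\<lambda>p. arrow_of p \<notin> A) (word D (Strand i))"
    by (auto simp: gather_def)
  then show ?thesis using c(1) unfolding adjacent_def consec_def by blast
qed

lemma string_link_delete_arrows:
  "virtual_string_link n D \<Longrightarrow> virtual_string_link n (delete_arrows A D)"
  by (simp add: virtual_string_link_def wf_delete_arrows)

lemma link_steps_delete:
  assumes D: "virtual_string_link n D"
    and "rm1_delete (gather A D) (delete_arrows A D) \<or> rm2_delete (gather A D) (delete_arrows A D)"
  shows "(link_step n)\<^sup>*\<^sup>* D (delete_arrows A D)"
proof -
  note steps = link_steps_gather[OF D, of A]
  have "link_step n (gather A D) (delete_arrows A D)"
    using assms(2) link_steps_string_link[OF steps D] string_link_delete_arrows[OF D]
    by (intro link_stepI) auto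
  with steps show ?thesis by (rule rtranclp.rtrancl_into_rtrancl)
qed

lemma string_link_unique_strand:
  assumes "virtual_string_link n D" "i \<in> {1..n}" "j \<in> {1..n}"
    and "p \<in> set (word D (Strand i))" "p \<in> set (word D (Strand j))"
  shows "j = i"
proof -
  have "Strand j = Strand i"
    using assms by (intro wf_gauss_unique_component[of D _ _ p]) (auto simp: virtual_string_link_def)
  then show ?thesis by simp
qed

lemma link_steps_delete_self_arrow:
  assumes D: "virtual_string_link n D" and i: "i \<in> {1..n}"
    and a: "Tail a \<in> set (word D (Strand i))" "Head a \<in> set (word D (Strand i))"
  shows "(link_step n)\<^sup>*\<^sup>* D (delete_arrows {a} D)"
proof (rule link_steps_delete[OF D])
  have "{r \<in> set (word D (Strand i)). arrow_of r \<in> {a}} = {Tail a, Head a}" (is "?S = _")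
  proof (intro equalityI subsetI)
    show "r \<in> {Tail a, Head a}" if "r \<in> ?S" for r using that by (cases r) auto
  qed (use a in auto)
  then have "adjacent (gather {a} D) (Tail a) (Head a)"
    by (rule adjacent_gather[OF D i]) simp
  then show "rm1_delete (gather {a} D) (delete_arrows {a} D) \<or>
      rm2_delete (gather {a} D) (delete_arrows {a} D)"
    unfolding rm1_delete_def using delete_gather by metis
qed

lemma link_steps_delete_opposite_arrows:
  assumes D: "virtual_string_link n D" and i: "i \<in> {1..n}" and j: "j \<in> {1..n}" and ij: "i \<noteq> j"
    and a: "Tail a \<in> set (word D (Strand i))" "Head a \<in> set (word D (Strand j))"
    and b: "Tail b \<in> set (word D (Strand i))" "Head b \<in> set (word D (Strand j))"
    and ab: "a \<noteq> b" "writhe D a = - writhe D b"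
  shows "(link_step n)\<^sup>*\<^sup>* D (delete_arrows {a, b} D)"
proof (rule link_steps_delete[OF D])
  \<comment> \<open>As the strands are different, each of them meets exactly two of the four ends:
    both tails on one, both heads on the other.\<close>
  have no: "Head a \<notin> set (word D (Strand i))" "Head b \<notin> set (word D (Strand i))"
      "Tail a \<notin> set (word D (Strand j))" "Tail b \<notin> set (word D (Strand j))"
    using string_link_unique_strand[OF D i j] a b ij by blast+
  have "{r \<in> set (word D (Strand i)). arrow_of r \<in> {a, b}} = {Tail a, Tail b}" (is "?S = _")
  proof (intro equalityI subsetI)
    show "r \<in> {Tail a, Tail b}" if "r \<in> ?S" for r using that no by (cases r) auto
  qed (use a b in auto)
  then have "adjacent (gather {a, b} D) (Tail a) (Tail b)"
    by (rule adjacent_gather[OF D i]) (simp add: ab)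
  moreover have "{r \<in> set (word D (Strand j)). arrow_of r \<in> {a, b}} = {Head a, Head b}" (is "?T = _")
  proof (intro equalityI subsetI)
    show "r \<in> {Head a, Head b}" if "r \<in> ?T" for r using that no by (cases r) auto
  qed (use a b in auto)
  then have "adjacent (gather {a, b} D) (Head a) (Head b)"
    by (rule adjacent_gather[OF D j]) (simp add: ab)
  moreover have "writhe (gather {a, b} D) = writhe D" by (simp add: gather_def)
  ultimately show "rm1_delete (gather {a, b} D) (delete_arrows {a, b} D) \<or>
      rm2_delete (gather {a, b} D) (delete_arrows {a, b} D)"
    unfolding rm2_delete_def using delete_gather ab by metis
qed

section \<open>Reduced diagrams and their comparison\<close>

definition signed_arrows :: "gauss_diagram \<Rightarrow> nat \<Rightarrow> nat \<Rightarrow> int \<Rightarrow> nat set" where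
  "signed_arrows D i j s =
     {a. Tail a \<in> set (word D (Strand i)) \<and> Head a \<in> set (word D (Strand j)) \<and> writhe D a = s}"

definition reduced :: "nat \<Rightarrow> gauss_diagram \<Rightarrow> bool" where
  "reduced n D \<longleftrightarrow> (\<forall>i\<in>{1..n}. \<forall>s. signed_arrows D i i s = {}) \<and>
     (\<forall>i\<in>{1..n}. \<forall>j\<in>{1..n}. signed_arrows D i j 1 = {} \<or> signed_arrows D i j (-1) = {})"

lemma link_steps_reduce:
  assumes "virtual_string_link n D"
  shows "\<exists>E. (link_step n)\<^sup>*\<^sup>* D E \<and> reduced n E"
  using assms
proof (induction "card (arrows D)" arbitrary: D rule: less_induct)
  case less
  show ?case
  proof (cases "reduced n D")
    case False
    have fin: "finite (arrows D)"
      using less.prems by (simp add: virtual_string_link_def finite_arrows)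
    have tail: "a \<in> arrows D" if "Tail a \<in> set (word D (Strand i))" "i \<in> {1..n}" for a i
      using arrow_of_in_arrows[OF less.prems that(2,1)] by simp
    \<comment> \<open>The element \<open>a\<close> certifies that deleting \<open>A\<close> really
      removes an arrow, so the induction on the number of arrows proceeds.\<close>
    obtain A a where "(link_step n)\<^sup>*\<^sup>* D (delete_arrows A D)" "a \<in> A" "a \<in> arrows D"
    proof (cases "\<exists>i\<in>{1..n}. \<exists>s. signed_arrows D i i s \<noteq> {}")
      case True
      then obtain i a where "i \<in> {1..n}" "Tail a \<in> set (word D (Strand i))"
          "Head a \<in> set (word D (Strand i))" by (auto simp: signed_arrows_def)
      then show ?thesis
        using link_steps_delete_self_arrow[OF less.prems] tail by (intro that) auto
    next
      case none: False
      then obtain i j a b where ij: "i \<in> {1..n}" "j \<in> {1..n}"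
        and a: "a \<in> signed_arrows D i j 1" and b: "b \<in> signed_arrows D i j (-1)"
        using False unfolding reduced_def by blast
      then have "i \<noteq> j" using none by blast
      moreover have "a \<noteq> b" using a b by (auto simp: signed_arrows_def)
      ultimately show ?thesis
        using link_steps_delete_opposite_arrows[OF less.prems ij, of a b] tail a b ij
        by (intro that[of "{a, b}" a]) (auto simp: signed_arrows_def)
    qed
    then have steps: "(link_step n)\<^sup>*\<^sup>* D (delete_arrows A D)" and a: "a \<in> A" "a \<in> arrows D" by auto
    have "card (arrows (delete_arrows A D)) < card (arrows D)"
      unfolding arrows_delete_arrows using fin a by (intro psubset_card_mono) auto
    from less.hyps[OF this string_link_delete_arrows[OF less.prems]] steps show ?thesis
      by (meson rtranclp_trans)
  qed auto
qed

lemma lk_signed_arrows: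
  assumes D: "virtual_string_link n D" and i: "i \<in> {1..n}" and j: "j \<in> {1..n}"
  shows "lk D i j = int (card (signed_arrows D i j 1)) - int (card (signed_arrows D i j (-1)))"
    and "finite (signed_arrows D i j s)"
proof -
  let ?S = "{a. Tail a \<in> set (word D (Strand i)) \<and> Head a \<in> set (word D (Strand j))}"
  have "?S \<subseteq> arrow_of ` set (word D (Strand i))" by force
  then have fin: "finite ?S" by (rule finite_subset) simp
  then show fb: "finite (signed_arrows D i j s)" for s
    by (rule rev_finite_subset) (auto simp: signed_arrows_def)
  have "writhe D a \<in> {1, -1}" if "a \<in> ?S" for a
  proof -
    have "a \<in> arrows D" using that arrow_of_in_arrows[OF D i, of "Tail a"] by simp
    then show ?thesis using D by (simp add: virtual_string_link_def wf_gauss_def)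
  qed
  then have S: "?S = signed_arrows D i j 1 \<union> signed_arrows D i j (-1)" by (auto simp: signed_arrows_def)
  have "lk D i j = sum (writhe D) (signed_arrows D i j 1) + sum (writhe D) (signed_arrows D i j (-1))"
    unfolding lk_def S by (rule sum.union_disjoint[OF fb fb]) (auto simp: signed_arrows_def)
  also have "\<dots> = sum (\<lambda>_. 1) (signed_arrows D i j 1) + sum (\<lambda>_. -1) (signed_arrows D i j (-1))"
    by (intro arg_cong2[of _ _ _ _ "(+)"] sum.cong) (auto simp: signed_arrows_def)
  finally show "lk D i j = int (card (signed_arrows D i j 1)) - int (card (signed_arrows D i j (-1)))" by simp
qed

text \<open>For different strands one of the two counts vanishes, so the counts are the positive and
  negative parts of the linking number. On the diagonal both are zero.\<close>

lemma reduced_card_signed_arrows: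
  assumes D: "virtual_string_link n D" "reduced n D" and E: "virtual_string_link n E" "reduced n E"
    and lk: "\<And>i j. i \<in> {1..n} \<Longrightarrow> j \<in> {1..n} \<Longrightarrow> i \<noteq> j \<Longrightarrow> lk D i j = lk E i j"
    and i: "i \<in> {1..n}" and j: "j \<in> {1..n}" and s: "s \<in> {1, -1}"
  shows "card (signed_arrows D i j s) = card (signed_arrows E i j s)"
proof (cases "i = j")
  case True
  then show ?thesis using D(2) E(2) i by (simp add: reduced_def)
next
  case False
  have "card (signed_arrows F i j 1) = 0 \<or> card (signed_arrows F i j (-1)) = 0" if "reduced n F" for F
    using that i j unfolding reduced_def by (metis card.empty)
  from this[OF D(2)] this[OF E(2)]
  show ?thesis
    using lk[OF i j False] lk_signed_arrows(1)[OF D(1) i j] lk_signed_arrows(1)[OF E(1) i j] s by auto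
qed

lemma signed_arrows_cases:
  assumes D: "virtual_string_link n D" and a: "a \<in> arrows D"
  obtains i j s where "i \<in> {1..n}" "j \<in> {1..n}" "s \<in> {1, -1}" "a \<in> signed_arrows D i j s"
proof -
  have "Tail a \<in> endpoints D" "Head a \<in> endpoints D" "writhe D a \<in> {1, -1}"
    using D a unfolding virtual_string_link_def wf_gauss_def by blast+
  then show ?thesis
    using that by (auto simp: endpoints_string_link[OF D] signed_arrows_def)
qed

lemma signed_arrows_unique:
  assumes D: "virtual_string_link n D"
    and "i \<in> {1..n}" "j \<in> {1..n}" "i' \<in> {1..n}" "j' \<in> {1..n}"
    and "a \<in> signed_arrows D i j s" "a \<in> signed_arrows D i' j' s'"
  shows "i' = i \<and> j' = j \<and> s' = s"
  using assms string_link_unique_strand[OF D] unfolding signed_arrows_def by blast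

text \<open>The arrows are partitioned by the strands of their tail and head and by their sign.
  Bijections between corresponding classes glue to one renaming, injective because the classes in
  \<open>E\<close> are disjoint as well.\<close>

lemma signed_arrows_bijection:
  assumes D: "virtual_string_link n D" and E: "virtual_string_link n E"
    and card: "\<And>i j s. i \<in> {1..n} \<Longrightarrow> j \<in> {1..n} \<Longrightarrow> s \<in> {1, -1} \<Longrightarrow>
      card (signed_arrows D i j s) = card (signed_arrows E i j s)"
  shows "\<exists>f. inj_on f (arrows D) \<and>
    (\<forall>i\<in>{1..n}. \<forall>j\<in>{1..n}. \<forall>s\<in>{1, -1}. f ` signed_arrows D i j s = signed_arrows E i j s)"
proof -
  have "\<exists>g. bij_betw g (signed_arrows D i j s) (signed_arrows E i j s)"
    if "i \<in> {1..n}" "j \<in> {1..n}" "s \<in> {1, -1}" for i j s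
    using that card lk_signed_arrows(2)[OF D] lk_signed_arrows(2)[OF E]
    by (intro finite_same_card_bij) auto
  then obtain g where g: "\<And>i j s. i \<in> {1..n} \<Longrightarrow> j \<in> {1..n} \<Longrightarrow> s \<in> {1, -1} \<Longrightarrow>
      bij_betw (g i j s) (signed_arrows D i j s) (signed_arrows E i j s)" by metis
  define strand_of where
    "strand_of p = (THE i. i \<in> {1..n} \<and> p \<in> set (word D (Strand i)))" for p
  define f where "f a = g (strand_of (Tail a)) (strand_of (Head a)) (writhe D a) a" for a
  have so: "strand_of p = i" if "i \<in> {1..n}" "p \<in> set (word D (Strand i))" for p i
    unfolding strand_of_def using that string_link_unique_strand[OF D] by (intro the_equality) auto
  have f: "f a = g i j s a" if "i \<in> {1..n}" "j \<in> {1..n}" "a \<in> signed_arrows D i j s" for i j s a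
    using that so unfolding f_def signed_arrows_def by simp
  have bij: "bij_betw f (signed_arrows D i j s) (signed_arrows E i j s)"
    if "i \<in> {1..n}" "j \<in> {1..n}" "s \<in> {1, -1}" for i j s
    using g[OF that] f[OF that(1,2)] by (simp cong: bij_betw_cong)
  have "inj_on f (arrows D)"
  proof (rule inj_onI)
    fix a b assume "a \<in> arrows D" "b \<in> arrows D" and eq: "f a = f b"
    then obtain i j s i' j' s' where
      a: "i \<in> {1..n}" "j \<in> {1..n}" "s \<in> {1, -1}" "a \<in> signed_arrows D i j s" and
      b: "i' \<in> {1..n}" "j' \<in> {1..n}" "s' \<in> {1, -1}" "b \<in> signed_arrows D i' j' s'"
      using signed_arrows_cases[OF D] by metis
    have "f a \<in> signed_arrows E i j s" "f a \<in> signed_arrows E i' j' s'"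
      using bij_betwE[OF bij[OF a(1-3)]] bij_betwE[OF bij[OF b(1-3)]] a(4) b(4) eq by metis+
    then have "b \<in> signed_arrows D i j s" using signed_arrows_unique[OF E] a b by metis
    then show "a = b"
      using bij_betw_imp_inj_on[OF bij[OF a(1-3)]] a(4) eq by (meson inj_onD)
  qed
  moreover have "f ` signed_arrows D i j s = signed_arrows E i j s"
    if "i \<in> {1..n}" "j \<in> {1..n}" "s \<in> {1, -1}" for i j s
    using bij[OF that] by (simp add: bij_betw_def)
  ultimately show ?thesis by blast
qed

text \<open>A renaming of arrows that respects tail strand, head strand and sign makes the two
  diagrams have the same endpoints on every strand. They then differ by a permutation along each
  strand.\<close>

lemma reduced_link_steps:
  assumes D: "virtual_string_link n D" "reduced n D" and E: "virtual_string_link n E" "reduced n E"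
    and lk: "\<And>i j. i \<in> {1..n} \<Longrightarrow> j \<in> {1..n} \<Longrightarrow> i \<noteq> j \<Longrightarrow> lk D i j = lk E i j"
  shows "(link_step n)\<^sup>*\<^sup>* D E"
proof -
  obtain f where inj: "inj_on f (arrows D)"
    and f: "\<And>i j s. i \<in> {1..n} \<Longrightarrow> j \<in> {1..n} \<Longrightarrow> s \<in> {1, -1} \<Longrightarrow>
      f ` signed_arrows D i j s = signed_arrows E i j s"
    using signed_arrows_bijection[OF D(1) E(1) reduced_card_signed_arrows[OF D E lk]] by blast
  note arD = arrow_of_in_arrows[OF D(1)]
  note arE = arrow_of_in_arrows[OF E(1)]
  have wr: "writhe E (f a) = writhe D a" if a_in: "a \<in> arrows D" for a
  proof -
    obtain i j s where a: "i \<in> {1..n}" "j \<in> {1..n}" "s \<in> {1, -1}" "a \<in> signed_arrows D i j s"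
      using a_in by (rule signed_arrows_cases[OF D(1)])
    then have "f a \<in> signed_arrows E i j s" using f[OF a(1-3)] by blast
    then show ?thesis using a(4) by (simp add: signed_arrows_def)
  qed
  \<comment> \<open>The intermediate diagram: isotopic to \<open>D\<close> through \<open>f\<close>,
    while each of its strands carries a permutation of the word in \<open>E\<close>.\<close>
  define F where "F = E\<lparr>word := \<lambda>c. map (map_endpoint f) (word D c)\<rparr>"
  have word_F: "mset (word F (Strand i)) = mset (word E (Strand i))" if i: "i \<in> {1..n}" for i
  proof -
    have "inj_on (map_endpoint f) (set (word D (Strand i)))"
    proof (rule inj_onI)
      fix p q
      assume p: "p \<in> set (word D (Strand i))" and q: "q \<in> set (word D (Strand i))"
        and eq: "map_endpoint f p = map_endpoint f q"
      show "p = q"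
        using inj_onD[OF inj _ arD[OF i p] arD[OF i q]] eq by (cases p; cases q) simp_all
    qed
    moreover have "distinct (word D (Strand i))" "distinct (word E (Strand i))"
      using D(1) E(1) i by (auto simp: virtual_string_link_def intro: wf_gauss_distinct)
    ultimately have dist: "distinct (word F (Strand i))" "distinct (word E (Strand i))"
      by (simp_all add: F_def distinct_map)
    have "set (word F (Strand i)) = set (word E (Strand i))"
    proof (intro equalityI subsetI)
      fix q assume "q \<in> set (word F (Strand i))"
      then obtain p where p: "p \<in> set (word D (Strand i))" "q = map_endpoint f p"
        by (auto simp: F_def)
      obtain i' j s where a: "i' \<in> {1..n}" "j \<in> {1..n}" "s \<in> {1, -1}" "arrow_of p \<in> signed_arrows D i' j s"
        using arD[OF i p(1)] by (rule signed_arrows_cases[OF D(1)])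
      then have "f (arrow_of p) \<in> signed_arrows E i' j s" using f[OF a(1-3)] by blast
      then show "q \<in> set (word E (Strand i))"
        using a p i string_link_unique_strand[OF D(1)]
        by (cases p) (auto simp: signed_arrows_def)
    next
      fix q assume q: "q \<in> set (word E (Strand i))"
      obtain i' j s where a: "i' \<in> {1..n}" "j \<in> {1..n}" "s \<in> {1, -1}" "arrow_of q \<in> signed_arrows E i' j s"
        using arE[OF i q] by (rule signed_arrows_cases[OF E(1)])
      then obtain b where b: "b \<in> signed_arrows D i' j s" "arrow_of q = f b"
        using f[OF a(1-3)] by blast
      show "q \<in> set (word F (Strand i))"
      proof (cases q)
        case (Tail x)
        then have "i' = i" using string_link_unique_strand[OF E(1) i a(1) q] a(4) by (auto simp: signed_arrows_def)
        then have "map_endpoint f (Tail b) \<in> set (word F (Strand i))"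
          using b(1) unfolding F_def by (simp add: signed_arrows_def del: endpoint.map)
        then show ?thesis using Tail b(2) by simp
      next
        case (Head x)
        then have "j = i" using string_link_unique_strand[OF E(1) i a(2) q] a(4) by (auto simp: signed_arrows_def)
        then have "map_endpoint f (Head b) \<in> set (word F (Strand i))"
          using b(1) unfolding F_def by (simp add: signed_arrows_def del: endpoint.map)
        then show ?thesis using Head b(2) by simp
      qed
    qed
    then show ?thesis using dist set_eq_iff_mset_eq_distinct by blast
  qed
  have F: "virtual_string_link n F"
    by (rule string_link_perm[OF E(1) _ _ word_F])
       (use E in \<open>auto simp: F_def virtual_string_link_def\<close>)
  have "isotopy id D F"
    unfolding isotopy_def
    by (intro conjI exI[of _ f])
       (use D(1) F inj wr in \<open>auto simp: F_def virtual_string_link_def\<close>)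
  then have "link_step n D F" using D(1) F by (intro link_stepI) auto
  moreover have "(link_step n)\<^sup>*\<^sup>* E F"
    by (rule link_steps_perm[OF E(1) _ _ word_F])
       (use E in \<open>auto simp: F_def virtual_string_link_def\<close>)
  ultimately show ?thesis by (meson converse_rtranclp_into_rtranclp link_steps_sym)
qed

lemma lk_link_steps:
  assumes D: "virtual_string_link n D" and E: "virtual_string_link n E"
    and lk: "\<And>i j. i \<in> {1..n} \<Longrightarrow> j \<in> {1..n} \<Longrightarrow> i \<noteq> j \<Longrightarrow> lk D i j = lk E i j"
  shows "(link_step n)\<^sup>*\<^sup>* D E"
proof -
  obtain D' E' where D': "(link_step n)\<^sup>*\<^sup>* D D'" "reduced n D'"
    and E': "(link_step n)\<^sup>*\<^sup>* E E'" "reduced n E'"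
    using link_steps_reduce D E by metis
  \<comment> \<open>Invariance of linking numbers under \<open>link_step\<close> is inherited from
    unwelded equivalence.\<close>
  have inv: "lk G i j = lk F i j"
    if "(link_step n)\<^sup>*\<^sup>* F G" "virtual_string_link n F" "i \<in> {1..n}" "j \<in> {1..n}" "i \<noteq> j" for F G i j
    using unwelded_equivalent_lk[OF link_steps_unwelded[OF that(1)]] that
    by (simp add: virtual_string_link_def)
  have "(link_step n)\<^sup>*\<^sup>* D' E'"
    using link_steps_string_link[OF D'(1) D] D'(2) link_steps_string_link[OF E'(1) E] E'(2)
    by (rule reduced_link_steps) (simp add: inv[OF D'(1) D] inv[OF E'(1) E] lk)
  then show ?thesis
    using D'(1) link_steps_sym[OF E'(1)] by (meson rtranclp_trans)
qed

theorem theorem1: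
  fixes n :: nat and L1 L2 :: gauss_diagram
  assumes "n \<ge> 1"
    and "virtual_string_link n L1"
    and "virtual_string_link n L2"
  shows "(cobordant n L1 L2 \<longleftrightarrow> unwelded_equivalent L1 L2) \<and>
    (unwelded_equivalent L1 L2 \<longleftrightarrow>
      (\<forall>i\<in>{1..n}. \<forall>j\<in>{1..n}. i \<noteq> j \<longrightarrow> lk L1 i j = lk L2 i j))"
proof -
  let ?lk = "\<forall>i\<in>{1..n}. \<forall>j\<in>{1..n}. i \<noteq> j \<longrightarrow> lk L1 i j = lk L2 i j"
  have "?lk" if "cobordant n L1 L2"
    using cobordant_lk[OF that assms(2,3)] by simp
  moreover have "?lk" if "unwelded_equivalent L1 L2"
    using unwelded_equivalent_lk[OF that] assms(2) by (simp add: virtual_string_link_def)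
  moreover have "cobordant n L1 L2 \<and> unwelded_equivalent L1 L2" if ?lk
  proof -
    have "(link_step n)\<^sup>*\<^sup>* L1 L2" using that by (intro lk_link_steps assms) blast
    then show ?thesis using link_steps_cobordant[OF _ assms(2)] link_steps_unwelded by blast
  qed
  ultimately show ?thesis by blast
qed

end
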